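(* Let $N$ be a nilpotent map of two-row type and let $A$ be a standard tableau on the Young shape of $N$. Then the component $K_A$ of the Springer fiber $\mathcal{B}_N$ is an iterated fiber bundle of base type $(\mathbb{CP}^1,\dots,\mathbb{CP}^1)$, where there are as many terms as there are numbers in the bottom row of $A$.
   Context: $V$ is an $n$-dimensional complex vector space. The Springer fiber $\mathcal{B}_N$ of a nilpotent map $N:V\to V$ is the variety of complete flags $F=(0=F_0\subset F_1\subset\dots\subset F_n=V)$ with $NF_i\subseteq F_{i-1}$ for all $i\ge 1$. The Young shape of $N$ has row lengths the sizes of the Jordan blocks of $N$. $N$ is of two-row type if it has at most two Jordan blocks; the shape then has rows of lengths $b\ge n-b$, where $b$ is the least positive integer with $N^b=0$ (the bottom row is empty if $b=n$). A standard tableau is a filling of the shape with $1,\dots,n$, decreasing left to right in rows and top to bottom in columns. For $F\in\mathcal{B}_N$ let $N_i$ be the map induced by $N$ on $V/F_i$. For a standard tableau $A$ on the shape of $N$, with $c(i)$ the column containing $i$, $SV(A)$ is the set of $F\in\mathcal{B}_N$ such that for every $i=1,\dots,n$: $F_i/F_{i-1}\subseteq \ker N_{i-1}\cap\operatorname{im}N_{i-1}^{c(i)-1}$ and $F_i/F_{i-1}\not\subseteq\operatorname{im}N_{i-1}^{c(i)}$. $K_A=\overline{SV(A)}$ is an irreducible component of $\mathcal{B}_N$; every component is of this form. A space $X_1$ is an iterated fiber bundle of base type $(B_1,\dots,B_m)$ if there are spaces $X_1,B_1,\dots,X_m,B_m,X_{m+1}=\mathrm{pt}$ and maps $p_j:X_j\to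 B_j$ that are fiber bundles with typical fiber $X_{j+1}$. *)

theory Defs
  imports "HOL-Analysis.Analysis" "HOL-Library.Set_Algebras"
begin

section \<open>Topologies on vector spaces, Grassmannians and flag varieties\<close>

definition quotient_topology :: "'a topology \<Rightarrow> ('a \<Rightarrow> 'b) \<Rightarrow> 'b topology" where
  "quotient_topology X f =
     topology (\<lambda>U. U \<subseteq> f ` topspace X \<and> openin X {x \<in> topspace X. f x \<in> U})"

lemma openin_quotient_topology:
  "openin (quotient_topology X f) U \<longleftrightarrow>
     U \<subseteq> f ` topspace X \<and> openin X {x \<in> topspace X. f x \<in> U}"
proof -
  have "istopology (\<lambda>U. U \<subseteq> f ` topspace X \<and> openin X {x \<in> topspace X. f x \<in> U})"
    unfolding istopology_def
  proof (rule conjI; clarify)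
    fix S T
    assume "S \<subseteq> f ` topspace X" "openin X {x \<in> topspace X. f x \<in> S}"
      and "T \<subseteq> f ` topspace X" "openin X {x \<in> topspace X. f x \<in> T}"
    moreover have "{x \<in> topspace X. f x \<in> S \<inter> T} =
        {x \<in> topspace X. f x \<in> S} \<inter> {x \<in> topspace X. f x \<in> T}"
      by auto
    ultimately show "S \<inter> T \<subseteq> f ` topspace X \<and> openin X {x \<in> topspace X. f x \<in> S \<inter> T}"
      by auto
  next
    fix K
    assume K: "\<forall>S\<in>K. S \<subseteq> f ` topspace X \<and> openin X {x \<in> topspace X. f x \<in> S}"
    have "{x \<in> topspace X. f x \<in> \<Union>K} = (\<Union>S\<in>K. {x \<in> topspace X. f x \<in> S})"
      by auto
    with K show "\<Union>K \<subseteq> f ` topspace X \<and> openin X {x \<in> topspace X. f x \<in> \<Union>K}"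
      by auto
  qed
  then show ?thesis
    unfolding quotient_topology_def by (simp add: topology_inverse')
qed

lemma topspace_quotient_topology [simp]:
  "topspace (quotient_topology X f) = f ` topspace X"
proof (rule subset_antisym)
  show "topspace (quotient_topology X f) \<subseteq> f ` topspace X"
    using openin_quotient_topology[of X f] by blast
  have "{x \<in> topspace X. f x \<in> f ` topspace X} = topspace X"
    by auto
  then show "f ` topspace X \<subseteq> topspace (quotient_topology X f)"
    by (intro openin_subset) (simp add: openin_quotient_topology)
qed

lemma quotient_map_quotient_topology: "quotient_map X (quotient_topology X f) f"
  by (simp add: quotient_map_def openin_quotient_topology)

text \<open>The canonical topology of a finite-dimensional complex vector space, given without reference
  to a basis: the coarsest topology making every linear functional continuous.\<close>

definition vs_topology :: "(complex \<Rightarrow> 'v::ab_group_add \<Rightarrow> 'v) \<Rightarrow> 'v topology" where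
  "vs_topology scl =
     topology_generated_by {f -` U |f U. Vector_Spaces.linear scl (*) f \<and> open U}"

definition frames :: "(complex \<Rightarrow> 'v::ab_group_add \<Rightarrow> 'v) \<Rightarrow> nat \<Rightarrow> (nat \<Rightarrow> 'v) set" where
  "frames scl k =
     {v \<in> {1..k} \<rightarrow>\<^sub>E UNIV. inj_on v {1..k} \<and> \<not> module.dependent scl (v ` {1..k})}"

text \<open>The points of the Grassmannian are the \<open>k\<close>-dimensional subspaces; its topology is the quotient
  topology for the map sending a linearly independent \<open>k\<close>-tuple to its span.\<close>

definition grassmannian :: "(complex \<Rightarrow> 'v::ab_group_add \<Rightarrow> 'v) \<Rightarrow> nat \<Rightarrow> 'v set topology" where
  "grassmannian scl k =
     quotient_topology
       (subtopology (product_topology (\<lambda>_. vs_topology scl) {1..k}) (frames scl k))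
       (\<lambda>v. module.span scl (v ` {1..k}))"

definition projective_line :: "(complex ^ 2) set topology" where
  "projective_line = grassmannian (*s) 1"

text \<open>Throughout, \<open>n\<close> is the dimension of the ambient space. A flag is a function on \<open>{0..n}\<close>,
  with the dummy value \<open>undefined\<close> elsewhere.\<close>

definition complete_flags ::
  "(complex \<Rightarrow> 'v::ab_group_add \<Rightarrow> 'v) \<Rightarrow> nat \<Rightarrow> (nat \<Rightarrow> 'v set) set" where
  "complete_flags scl n =
     {F \<in> {0..n} \<rightarrow>\<^sub>E {S. module.subspace scl S}.
        F 0 = {0} \<and> F n = UNIV \<and> (\<forall>i<n. F i \<subset> F (Suc i))}"

definition flag_variety ::
  "(complex \<Rightarrow> 'v::ab_group_add \<Rightarrow> 'v) \<Rightarrow> nat \<Rightarrow> (nat \<Rightarrow> 'v set) topology" where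
  "flag_variety scl n =
     subtopology (product_topology (grassmannian scl) {0..n}) (complete_flags scl n)"

section \<open>Nilpotent maps, Young shapes and standard tableaux\<close>

definition nilpotent_map :: "('v::ab_group_add \<Rightarrow> 'v) \<Rightarrow> bool" where
  "nilpotent_map N \<longleftrightarrow> (\<exists>k. \<forall>v. (N ^^ k) v = 0)"

text \<open>Shapes are lists of row lengths; cells are pairs (row, column), both counted from 1.\<close>

definition young_cells :: "nat list \<Rightarrow> (nat \<times> nat) set" where
  "young_cells ls = {(r, c). r \<in> {1..length ls} \<and> c \<in> {1..ls ! (r - 1)}}"

text \<open>The list \<open>ls\<close> consists of the sizes of the Jordan blocks of the nilpotent map \<open>N\<close>, in weakly
  decreasing order. The Jordan basis is indexed by the cells of the shape, one block for each row.\<close>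

definition jordan_shape ::
  "(complex \<Rightarrow> 'v::ab_group_add \<Rightarrow> 'v) \<Rightarrow> ('v \<Rightarrow> 'v) \<Rightarrow> nat list \<Rightarrow> bool" where
  "jordan_shape scl N ls \<longleftrightarrow>
     sorted_wrt (\<ge>) ls \<and> 0 \<notin> set ls \<and>
     (\<exists>e. inj_on e (young_cells ls) \<and>
          \<not> module.dependent scl (e ` young_cells ls) \<and>
          module.span scl (e ` young_cells ls) = UNIV \<and>
          (\<forall>(r, c) \<in> young_cells ls. N (e (r, c)) = (if c = 1 then 0 else e (r, c - 1))))"

text \<open>Entries decrease along rows and columns, so that \<open>1\<close> sits at an outer corner.\<close>

definition standard_tableau :: "nat \<Rightarrow> nat list \<Rightarrow> (nat \<times> nat \<Rightarrow> nat) \<Rightarrow> bool" where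
  "standard_tableau n ls A \<longleftrightarrow>
     bij_betw A (young_cells ls) {1..n} \<and>
     (\<forall>r c c'. (r, c) \<in> young_cells ls \<longrightarrow> (r, c') \<in> young_cells ls \<longrightarrow> c < c' \<longrightarrow>
        A (r, c') < A (r, c)) \<and>
     (\<forall>r r' c. (r, c) \<in> young_cells ls \<longrightarrow> (r', c) \<in> young_cells ls \<longrightarrow> r < r' \<longrightarrow>
        A (r', c) < A (r, c))"

definition column_of :: "nat list \<Rightarrow> (nat \<times> nat \<Rightarrow> nat) \<Rightarrow> nat \<Rightarrow> nat" where
  "column_of ls A i = snd (the_inv_into (young_cells ls) A i)"

text \<open>The numbers in the second row of a tableau with at most two rows; empty if there is only one
  row.\<close>

definition bottom_row :: "nat list \<Rightarrow> (nat \<times> nat \<Rightarrow> nat) \<Rightarrow> nat set" where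
  "bottom_row ls A = {A (2, c) |c. (2, c) \<in> young_cells ls}"

section \<open>Springer fibers and their components\<close>

definition springer_fiber ::
  "(complex \<Rightarrow> 'v::ab_group_add \<Rightarrow> 'v) \<Rightarrow> nat \<Rightarrow> ('v \<Rightarrow> 'v) \<Rightarrow> (nat \<Rightarrow> 'v set) set" where
  "springer_fiber scl n N =
     {F \<in> complete_flags scl n. \<forall>i\<in>{1..n}. N ` F i \<subseteq> F (i - 1)}"

text \<open>\<open>quot_by W U\<close> is the image \<open>(U + W)/W\<close> of \<open>U\<close> in the quotient \<open>V/W\<close>, whose elements are the
  cosets \<open>v +o W\<close> and whose zero is \<open>W\<close>. If \<open>N\<close> maps \<open>W\<close> into itself, \<open>induced_map N W\<close> sends
  \<open>v +o W\<close> to \<open>N v +o W\<close>.\<close>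

definition quot_by :: "'v::ab_group_add set \<Rightarrow> 'v set \<Rightarrow> 'v set set" where
  "quot_by W U = (\<lambda>v. v +o W) ` U"

definition induced_map :: "('v::ab_group_add \<Rightarrow> 'v) \<Rightarrow> 'v set \<Rightarrow> 'v set \<Rightarrow> 'v set" where
  "induced_map N W C = N ` C + W"

definition induced_kernel :: "('v::ab_group_add \<Rightarrow> 'v) \<Rightarrow> 'v set \<Rightarrow> 'v set set" where
  "induced_kernel N W = {C \<in> quot_by W UNIV. induced_map N W C = W}"

definition induced_image_power ::
  "('v::ab_group_add \<Rightarrow> 'v) \<Rightarrow> 'v set \<Rightarrow> nat \<Rightarrow> 'v set set" where
  "induced_image_power N W k = (induced_map N W ^^ k) ` quot_by W UNIV"

definition SV ::
  "(complex \<Rightarrow> 'v::ab_group_add \<Rightarrow> 'v) \<Rightarrow> nat \<Rightarrow> ('v \<Rightarrow> 'v) \<Rightarrow> nat list \<Rightarrow>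
     (nat \<times> nat \<Rightarrow> nat) \<Rightarrow> (nat \<Rightarrow> 'v set) set" where
  "SV scl n N ls A =
     {F \<in> springer_fiber scl n N. \<forall>i\<in>{1..n}.
        quot_by (F (i - 1)) (F i) \<subseteq>
          induced_kernel N (F (i - 1)) \<inter>
          induced_image_power N (F (i - 1)) (column_of ls A i - 1) \<and>
        \<not> quot_by (F (i - 1)) (F i) \<subseteq>
          induced_image_power N (F (i - 1)) (column_of ls A i)}"

definition springer_component ::
  "(complex \<Rightarrow> 'v::ab_group_add \<Rightarrow> 'v) \<Rightarrow> nat \<Rightarrow> ('v \<Rightarrow> 'v) \<Rightarrow> nat list \<Rightarrow>
     (nat \<times> nat \<Rightarrow> nat) \<Rightarrow> (nat \<Rightarrow> 'v set) set" where
  "springer_component scl n N ls A =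
     subtopology (flag_variety scl n) (springer_fiber scl n N) closure_of SV scl n N ls A"

section \<open>Iterated fiber bundles\<close>

definition fiber_bundle ::
  "'a topology \<Rightarrow> 'b topology \<Rightarrow> ('a \<Rightarrow> 'b) \<Rightarrow> 'c topology \<Rightarrow> bool" where
  "fiber_bundle X B p T \<longleftrightarrow>
     continuous_map X B p \<and>
     (\<forall>b\<in>topspace B. \<exists>U h. openin B U \<and> b \<in> U \<and>
        homeomorphic_map (subtopology X {x \<in> topspace X. p x \<in> U})
          (prod_topology (subtopology B U) T) h \<and>
        (\<forall>x\<in>topspace X. p x \<in> U \<longrightarrow> fst (h x) = p x))"

text \<open>The total spaces \<open>Xs 0, Xs 1, \<dots>\<close> share one type of points. For nonempty base spaces this is
  no restriction: the typical fiber matters only up to homeomorphism, so it may be taken to be an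
  actual fiber, which is a subspace of the previous total space.\<close>

definition iterated_fiber_bundle :: "'a topology \<Rightarrow> 'b topology list \<Rightarrow> bool" where
  "iterated_fiber_bundle X Bs \<longleftrightarrow>
     (\<exists>(Xs :: nat \<Rightarrow> 'a topology) (p :: nat \<Rightarrow> 'a \<Rightarrow> 'b).
        Xs 0 = X \<and>
        (\<forall>j<length Bs. fiber_bundle (Xs j) (Bs ! j) (p j) (Xs (Suc j))) \<and>
        (\<exists>x. topspace (Xs (length Bs)) = {x}))"

end

theory Submission
  imports Defs
begin

text \<open>The component is homeomorphic to a product of projective lines, one for each number in the bottom
row of the tableau, and such a product is an iterated bundle all of whose stages are trivial
(\<open>iterated_fiber_bundle_of_product\<close>).

The homeomorphism comes from the following model. A Jordan basis embeds \<open>V\<close> into the space of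
sequences in \<open>\<complex>\<^sup>2\<close> in such a way that \<open>N\<close> becomes the shift \<open>w \<mapsto> (k \<mapsto> w (k + 1))\<close>; the first
coordinate carries the longer block. The kernel of the shift is a copy of \<open>\<complex>\<^sup>2\<close> in position \<open>0\<close>. For a
projection \<open>q\<close> of \<open>\<complex>\<^sup>2\<close>, let \<open>shift_on q\<close> shift the \<open>q\<close>-part of a sequence and fix the rest. This
operator is surjective, it commutes with the shift, and its kernel is the image of \<open>q\<close>, put in
position \<open>0\<close>. So projections \<open>q\<^sub>1, \<dots>, q\<^sub>n\<close> of rank one yield a chain of subspaces
\<open>F\<^sub>i = ker (shift_on q\<^sub>i \<circ> \<dots> \<circ> shift_on q\<^sub>1)\<close>, each of codimension one in the next, and the shift
maps \<open>F\<^sub>i\<close> into \<open>F\<^sub>i\<^sub>-\<^sub>1\<close>. Moreover \<open>shift_on (1 - q) \<circ> shift_on q\<close> is the shift itself.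

The tableau selects the projections. Read \<open>1, \<dots>, n\<close> as parentheses: a number in the bottom row
opens, and a number in the top row closes the last open one, if there is any. At an opening
parenthesis take the orthogonal projection to an arbitrary line; at the matching closing one take the
complementary projection; at an unmatched number take the projection to the first coordinate. A
matched pair then contributes a shift, and an unmatched number a shift of the first coordinate only,
so that the final kernel is precisely \<open>V\<close> and \<open>F\<close> is a flag in the Springer fiber. This gives a map
\<open>flag_of\<close> from the product of projective lines to the Springer fiber.

Four facts make it a homeomorphism onto the component. First, it is injective, because the line
at \<open>i\<close> is read off from \<open>F\<^sub>i\<close> once the earlier lines are known. Secondly, it hits all flags
in \<open>SV(A)\<close>: at a number in the top row, the condition on \<open>F\<^sub>i/F\<^sub>i\<^sub>-\<^sub>1\<close> to lie in a high power of the
induced map leaves just one line, the one prescribed above (\<open>top_forced\<close>). Thirdly, its values lie in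
\<open>SV(A)\<close> whenever no line is orthogonal to the line of the innermost enclosing parenthesis, and no line
without enclosing parenthesis is the first axis (\<open>generic_column\<close>); such families of lines are dense
(\<open>generic_dense\<close>). Finally, it is continuous, the product of projective lines is compact, and flag varieties are Hausdorff. So its
image is closed and equals the closure of \<open>SV(A)\<close>, and it is a homeomorphism onto that image.\<close>

section \<open>Grassmannians are Hausdorff\<close>

lemma continuous_map_mult_algebra:
  fixes f g :: "'a \<Rightarrow> 'b::real_normed_algebra"
  assumes "continuous_map X euclidean f" "continuous_map X euclidean g"
  shows "continuous_map X euclidean (\<lambda>x. f x * g x)"
  using assms by (simp add: continuous_map_atin tendsto_mult)

locale complex_vector_space = vector_space scl
  for scl :: "complex \<Rightarrow> 'v::ab_group_add \<Rightarrow> 'v"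
begin

definition linear_functional :: "('v \<Rightarrow> complex) \<Rightarrow> bool" where
  "linear_functional f \<longleftrightarrow> Vector_Spaces.linear scl (*) f"

lemma linear_functional_props:
  assumes "linear_functional f"
  shows "f (x + y) = f x + f y" "f (x - y) = f x - f y" "f (scl c x) = c * f x" "f 0 = 0"
    "f (sum g I) = (\<Sum>i\<in>I. f (g i))"
proof -
  interpret f: Vector_Spaces.linear scl "(*)" f
    using assms by (simp add: linear_functional_def)
  show "f (x + y) = f x + f y" "f (x - y) = f x - f y" "f (scl c x) = c * f x" "f 0 = 0"
    "f (sum g I) = (\<Sum>i\<in>I. f (g i))"
    by (simp_all add: f.add f.diff f.scale f.zero f.sum)
qed

lemma linear_functional_zero: "linear_functional (\<lambda>_. 0)"
proof -
  interpret pair: vector_space_pair scl "(*) :: complex \<Rightarrow> complex \<Rightarrow> complex" ..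
  show ?thesis
    unfolding linear_functional_def by (rule pair.linear_zero)
qed

text \<open>The preimages of open sets under linear functionals generate the topology.\<close>

lemma continuous_into_vs_topology_iff:
  "continuous_map X (vs_topology scl) g \<longleftrightarrow>
     (\<forall>f. linear_functional f \<longrightarrow> continuous_map X euclidean (\<lambda>x. f (g x)))"
proof -
  have "(\<lambda>_. 0) -` UNIV \<in> {f -` U |f U. Vector_Spaces.linear scl (*) f \<and> open (U :: complex set)}"
    using linear_functional_zero unfolding linear_functional_def by blast
  then have "UNIV \<subseteq> \<Union> {f -` U |f U. Vector_Spaces.linear scl (*) f \<and> open (U :: complex set)}"
    unfolding vimage_UNIV by (rule Union_upper)
  then have "continuous_map X (vs_topology scl) g \<longleftrightarrow>
      (\<forall>f U. linear_functional f \<longrightarrow> open U \<longrightarrow> openin X (g -` (f -` U) \<inter> topspace X))"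
    unfolding vs_topology_def continuous_on_generated_topo_iff linear_functional_def by auto
  also have "\<dots> \<longleftrightarrow> (\<forall>f. linear_functional f \<longrightarrow> continuous_map X euclidean (\<lambda>x. f (g x)))"
    unfolding continuous_map_alt by (auto simp: vimage_def)
  finally show ?thesis .
qed

lemma topspace_vs_topology [simp]: "topspace (vs_topology scl) = UNIV"
proof -
  have "continuous_map (discrete_topology UNIV) (vs_topology scl) id"
    by (simp add: continuous_into_vs_topology_iff)
  then show ?thesis
    by (auto simp: continuous_map_def)
qed

lemma continuous_linear_functional:
  assumes "linear_functional f"
  shows "continuous_map (vs_topology scl) euclidean f"
  using continuous_into_vs_topology_iff[of "vs_topology scl" id] assms by simp

lemma span_family:
  assumes "finite I"
  shows "span (v ` I) = range (\<lambda>c. \<Sum>i\<in>I. scl (c i) (v i))"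
proof
  show "range (\<lambda>c. \<Sum>i\<in>I. scl (c i) (v i)) \<subseteq> span (v ` I)"
    by (intro image_subsetI span_sum span_scale span_base imageI)
  have "subspace (range (\<lambda>c. \<Sum>i\<in>I. scl (c i) (v i)))"
    unfolding subspace_def
  proof (intro conjI ballI allI)
    show "0 \<in> range (\<lambda>c. \<Sum>i\<in>I. scl (c i) (v i))"
      by (rule range_eqI[of _ _ "\<lambda>_. 0"]) simp
  next
    fix x y assume "x \<in> range (\<lambda>c. \<Sum>i\<in>I. scl (c i) (v i))" "y \<in> range (\<lambda>c. \<Sum>i\<in>I. scl (c i) (v i))"
    then obtain a b where "x = (\<Sum>i\<in>I. scl (a i) (v i))" "y = (\<Sum>i\<in>I. scl (b i) (v i))"
      by auto
    then show "x + y \<in> range (\<lambda>c. \<Sum>i\<in>I. scl (c i) (v i))"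
      by (intro range_eqI[of _ _ "\<lambda>i. a i + b i"]) (simp add: scale_left_distrib sum.distrib)
  next
    fix k x assume "x \<in> range (\<lambda>c. \<Sum>i\<in>I. scl (c i) (v i))"
    then obtain a where "x = (\<Sum>i\<in>I. scl (a i) (v i))"
      by auto
    then show "scl k x \<in> range (\<lambda>c. \<Sum>i\<in>I. scl (c i) (v i))"
      by (intro range_eqI[of _ _ "\<lambda>i. k * a i"]) (simp add: scale_sum_right)
  qed
  moreover have "v ` I \<subseteq> range (\<lambda>c. \<Sum>i\<in>I. scl (c i) (v i))"
  proof clarify
    fix j assume "j \<in> I"
    then have "v j = (\<Sum>i\<in>I. scl (if i = j then 1 else 0) (v i))"
      using assms by (simp add: if_distrib[where f="\<lambda>c. scl c _"] sum.delta cong: if_cong)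
    then show "v j \<in> range (\<lambda>c. \<Sum>i\<in>I. scl (c i) (v i))"
      by (rule range_eqI[of _ _ "\<lambda>i. if i = j then 1 else 0"])
  qed
  ultimately show "span (v ` I) \<subseteq> range (\<lambda>c. \<Sum>i\<in>I. scl (c i) (v i))"
    by (rule span_minimal[rotated])
qed

lemma independent_family_iff:
  assumes "finite I"
  shows "inj_on v I \<and> independent (v ` I) \<longleftrightarrow>
    (\<forall>c. (\<Sum>i\<in>I. scl (c i) (v i)) = 0 \<longrightarrow> (\<forall>i\<in>I. c i = 0))"
proof (intro iffI allI impI ballI; (elim conjE)?)
  fix c i assume inj: "inj_on v I" and ind: "independent (v ` I)"
    and 0: "(\<Sum>i\<in>I. scl (c i) (v i)) = 0" and "i \<in> I"
  have "(\<Sum>x\<in>v ` I. scl (c (the_inv_into I v x)) x) = (\<Sum>i\<in>I. scl (c i) (v i))"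
    using inj by (subst sum.reindex) (auto intro!: sum.cong simp: the_inv_into_f_f)
  then have "c (the_inv_into I v (v i)) = 0"
    using 0 ind \<open>i \<in> I\<close> assms
    by (intro independentD[OF ind, of "v ` I" "\<lambda>x. c (the_inv_into I v x)"]) auto
  then show "c i = 0"
    using inj \<open>i \<in> I\<close> by (simp add: the_inv_into_f_f)
next
  assume *: "\<forall>c. (\<Sum>i\<in>I. scl (c i) (v i)) = 0 \<longrightarrow> (\<forall>i\<in>I. c i = 0)"
  have inj: "inj_on v I"
  proof (rule inj_onI, rule ccontr)
    fix a b assume ab: "a \<in> I" "b \<in> I" "v a = v b" "a \<noteq> b"
    define c :: "_ \<Rightarrow> complex" where "c = (\<lambda>i. if i = a then 1 else if i = b then - 1 else 0)"
    have "(\<Sum>i\<in>I. scl (c i) (v i)) = (\<Sum>i\<in>{a, b}. scl (c i) (v i))"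
      using ab assms by (intro sum.mono_neutral_right) (auto simp: c_def)
    also have "\<dots> = 0"
      using ab by (simp add: c_def)
    finally have "c a = 0"
      using * ab by blast
    then show False by (simp add: c_def)
  qed
  moreover have "independent (v ` I)"
  proof
    assume "dependent (v ` I)"
    then obtain u where u: "\<exists>x\<in>v ` I. u x \<noteq> 0" "(\<Sum>x\<in>v ` I. scl (u x) x) = 0"
      using assms by (auto simp: dependent_finite)
    have "(\<Sum>i\<in>I. scl (u (v i)) (v i)) = 0"
      using u(2) inj by (simp add: sum.reindex)
    then have "\<forall>i\<in>I. u (v i) = 0"
      using *[rule_format, of "\<lambda>i. u (v i)"] by blast
    then show False using u(1) by auto
  qed
  ultimately show "inj_on v I \<and> independent (v ` I)" by blast
qed

lemma frames_iff:
  "v \<in> frames scl k \<longleftrightarrow> v \<in> extensional {1..k} \<and>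
     (\<forall>c. (\<Sum>i\<in>{1..k}. scl (c i) (v i)) = 0 \<longrightarrow> (\<forall>i\<in>{1..k}. c i = 0))"
  using independent_family_iff[of "{1..k}" v] by (auto simp: frames_def PiE_def)

text \<open>A square matrix close to the identity is invertible, by diagonal dominance; hence a family
  on which functionals take almost dual values is independent.\<close>

lemma almost_dual_imp_independent:
  assumes "finite I" and f: "\<And>a. a \<in> I \<Longrightarrow> linear_functional (f a)"
    and close: "\<And>a b. a \<in> I \<Longrightarrow> b \<in> I \<Longrightarrow> cmod (f a (z b) - (if a = b then 1 else 0)) < 1 / card I"
    and 0: "(\<Sum>b\<in>I. scl (c b) (z b)) = 0" and "i \<in> I"
  shows "c i = 0"
proof (rule ccontr)
  assume "c i \<noteq> 0"
  define m where "m = Max ((\<lambda>b. cmod (c b)) ` I)"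
  have "m \<in> (\<lambda>b. cmod (c b)) ` I"
    unfolding m_def using assms by (intro Max_in) auto
  then obtain a where a: "a \<in> I" "cmod (c a) = m" by auto
  have le: "cmod (c b) \<le> m" if "b \<in> I" for b
    unfolding m_def using assms that by auto
  have "m > 0"
    using le[OF \<open>i \<in> I\<close>] \<open>c i \<noteq> 0\<close> by (smt (verit) zero_less_norm_iff)
  have "0 = f a (\<Sum>b\<in>I. scl (c b) (z b))"
    using 0 f[OF a(1)] by (simp add: linear_functional_props)
  also have "\<dots> = (\<Sum>b\<in>I. c b * f a (z b))"
    using f[OF a(1)] by (simp add: linear_functional_props)
  also have "\<dots> = (\<Sum>b\<in>I. c b * (f a (z b) - (if a = b then 1 else 0))) + (\<Sum>b\<in>I. if a = b then c b else 0)"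
    unfolding sum.distrib[symmetric] by (intro sum.cong) (auto simp: algebra_simps)
  finally have "c a = - (\<Sum>b\<in>I. c b * (f a (z b) - (if a = b then 1 else 0)))"
    using a \<open>finite I\<close> by (simp add: add_eq_0_iff)
  then have "m \<le> (\<Sum>b\<in>I. cmod (c b * (f a (z b) - (if a = b then 1 else 0))))"
    using a(2) norm_sum[of "\<lambda>b. c b * (f a (z b) - (if a = b then 1 else 0))" I] by simp
  also have "\<dots> < (\<Sum>b\<in>I. m * (1 / card I))"
  proof (rule sum_strict_mono)
    fix b assume "b \<in> I"
    have "cmod (c b) * cmod (f a (z b) - (if a = b then 1 else 0)) < m * (1 / card I)"
      using le[OF \<open>b \<in> I\<close>] close[OF a(1) \<open>b \<in> I\<close>] \<open>m > 0\<close>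
      by (smt (verit) mult_less_cancel_left_pos mult_right_mono norm_ge_zero)
    then show "cmod (c b * (f a (z b) - (if a = b then 1 else 0))) < m * (1 / card I)"
      by (simp add: norm_mult)
  qed (use assms in auto)
  also have "\<dots> = m"
    using assms by auto
  finally show False by simp
qed

text \<open>Functionals dual to an independent family detect independence of all nearby families.\<close>

lemma dual_functionals:
  assumes "\<And>c i. (\<Sum>i\<in>I. scl (c i) (z i)) = 0 \<Longrightarrow> i \<in> I \<Longrightarrow> c i = 0" and "finite I"
  obtains f where "\<And>a. linear_functional (f a)"
    "\<And>a b. a \<in> I \<Longrightarrow> b \<in> I \<Longrightarrow> f a (z b) = (if a = b then 1 else 0)"
proof -
  have ind: "inj_on z I" "independent (z ` I)"
    using assms independent_family_iff[of I z] by blast+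
  interpret pair: vector_space_pair scl "(*) :: complex \<Rightarrow> complex \<Rightarrow> complex" ..
  have "\<forall>a. \<exists>g. linear_functional g \<and>
      (\<forall>x\<in>z ` I. g x = (if a = the_inv_into I z x then 1 else 0))"
    unfolding linear_functional_def
    by (intro allI pair.linear_independent_extend[OF ind(2)])
  then obtain f where f: "\<And>a. linear_functional (f a)"
      "\<And>a x. x \<in> z ` I \<Longrightarrow> f a x = (if a = the_inv_into I z x then 1 else 0)"
    by metis
  show ?thesis
    by (rule that[of f]) (use f ind(1) in \<open>auto simp: the_inv_into_f_f\<close>)
qed

definition frame_space :: "nat \<Rightarrow> (nat \<Rightarrow> 'v) topology" where
  "frame_space k = subtopology (product_topology (\<lambda>_. vs_topology scl) {1..k}) (frames scl k)"

lemma topspace_frame_space [simp]: "topspace (frame_space k) = frames scl k"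
  by (auto simp: frames_def frame_space_def)

lemma continuous_frame_component:
  assumes "i \<in> {1..k}"
  shows "continuous_map (frame_space k) (vs_topology scl) (\<lambda>v. v i)"
  unfolding frame_space_def
  using assms by (intro continuous_map_from_subtopology continuous_map_product_projection)

lemma topspace_grassmannian:
  "topspace (grassmannian scl k) = (\<lambda>v. span (v ` {1..k})) ` frames scl k"
  unfolding grassmannian_def topspace_quotient_topology topspace_frame_space[unfolded frame_space_def] ..

lemma quotient_map_grassmannian:
  "quotient_map (frame_space k) (grassmannian scl k) (\<lambda>v. span (v ` {1..k}))"
  unfolding grassmannian_def frame_space_def by (rule quotient_map_quotient_topology)

text \<open>If \<open>v\<close> and \<open>w\<close> span the same subspace, the change of basis from \<open>w\<close> to \<open>v\<close>, applied to
  all frames, is a homeomorphism that preserves spans and takes \<open>w\<close> to \<open>v\<close>. So the set of frames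
  with the same span as a member of a given open set is open.\<close>

lemma open_map_grassmannian:
  "open_map (frame_space k) (grassmannian scl k) (\<lambda>v. span (v ` {1..k}))"
  unfolding open_map_def
proof (intro allI impI)
  let ?sp = "\<lambda>v. span (v ` {1..k})"
  fix U assume U: "openin (frame_space k) U"
  then have Uf: "U \<subseteq> frames scl k"
    using openin_subset by fastforce
  define P where "P = {w \<in> frames scl k. ?sp w \<in> ?sp ` U}"
  have "\<exists>Q. openin (frame_space k) Q \<and> w \<in> Q \<and> Q \<subseteq> P" if wP: "w \<in> P" for w
  proof -
    from wP have w: "w \<in> frames scl k"
      by (simp add: P_def)
    from wP obtain v where v: "v \<in> U" "?sp v = ?sp w"
      unfolding P_def by force
    have "\<forall>a. a \<in> {1..k} \<longrightarrow> (\<exists>g. v a = (\<Sum>b\<in>{1..k}. scl (g b) (w b)))"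
      using v(2) span_base[of _ "v ` {1..k}"] span_family[of "{1..k}" w] by fastforce
    then obtain g where g: "\<And>a. a \<in> {1..k} \<Longrightarrow> v a = (\<Sum>b\<in>{1..k}. scl (g a b) (w b))"
      by metis
    have "\<forall>b. b \<in> {1..k} \<longrightarrow> (\<exists>h. w b = (\<Sum>a\<in>{1..k}. scl (h a) (v a)))"
      using v(2) span_base[of _ "w ` {1..k}"] span_family[of "{1..k}" v] by fastforce
    then obtain h where h: "\<And>b. b \<in> {1..k} \<Longrightarrow> w b = (\<Sum>a\<in>{1..k}. scl (h b a) (v a))"
      by metis
    have comb: "(\<Sum>a\<in>{1..k}. scl (f a) (\<Sum>b\<in>{1..k}. scl (e a b) (x b))) =
        (\<Sum>b\<in>{1..k}. scl (\<Sum>a\<in>{1..k}. f a * e a b) (x b))" for f e and x :: "nat \<Rightarrow> 'v"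
      by (simp add: scale_sum_right scale_sum_left) (rule sum.swap)
    \<comment> \<open>The matrices of the two changes of basis are inverse to each other.\<close>
    have hg: "(\<Sum>a\<in>{1..k}. h b a * g a c) = (if b = c then 1 else 0)"
      if "b \<in> {1..k}" "c \<in> {1..k}" for b c
    proof -
      have "w b = (\<Sum>c\<in>{1..k}. scl (\<Sum>a\<in>{1..k}. h b a * g a c) (w c))"
        using h[OF that(1)] g comb[of "h b" g w] by simp
      moreover have "w b = (\<Sum>c\<in>{1..k}. scl (if b = c then 1 else 0) (w c))"
        using that(1) by (simp add: if_distrib[where f="\<lambda>c. scl c _"] cong: if_cong)
      ultimately have "(\<Sum>c\<in>{1..k}. scl ((\<Sum>a\<in>{1..k}. h b a * g a c) - (if b = c then 1 else 0)) (w c)) = 0"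
        by (simp add: scale_left_diff_distrib sum_subtractf)
      then show ?thesis
        using w that(2) unfolding frames_iff by fastforce
    qed
    have gh: "(\<Sum>b\<in>{1..k}. g a b * h b c) = (if a = c then 1 else 0)"
      if "a \<in> {1..k}" "c \<in> {1..k}" for a c
    proof -
      have "v a = (\<Sum>c\<in>{1..k}. scl (\<Sum>b\<in>{1..k}. g a b * h b c) (v c))"
        using g[OF that(1)] h comb[of "g a" h v] by simp
      moreover have "v a = (\<Sum>c\<in>{1..k}. scl (if a = c then 1 else 0) (v c))"
        using that(1) by (simp add: if_distrib[where f="\<lambda>c. scl c _"] cong: if_cong)
      ultimately have "(\<Sum>c\<in>{1..k}. scl ((\<Sum>b\<in>{1..k}. g a b * h b c) - (if a = c then 1 else 0)) (v c)) = 0"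
        by (simp add: scale_left_diff_distrib sum_subtractf)
      moreover have "v \<in> frames scl k"
        using v(1) Uf by blast
      ultimately show ?thesis
        using that(2) unfolding frames_iff by fastforce
    qed
    define G where "G = (\<lambda>x::nat \<Rightarrow> 'v. \<lambda>a\<in>{1..k}. \<Sum>b\<in>{1..k}. scl (g a b) (x b))"
    have inv: "x b = (\<Sum>a\<in>{1..k}. scl (h b a) (G x a))" if "b \<in> {1..k}" for x b
    proof -
      have "(\<Sum>a\<in>{1..k}. scl (h b a) (G x a)) =
          (\<Sum>a\<in>{1..k}. scl (h b a) (\<Sum>b\<in>{1..k}. scl (g a b) (x b)))"
        by (intro sum.cong) (auto simp: G_def)
      also have "\<dots> = (\<Sum>c\<in>{1..k}. scl (\<Sum>a\<in>{1..k}. h b a * g a c) (x c))"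
        by (rule comb)
      also have "\<dots> = (\<Sum>c\<in>{1..k}. scl (if b = c then 1 else 0) (x c))"
        using hg that by (intro sum.cong) auto
      also have "\<dots> = x b"
        using that by (simp add: if_distrib[where f="\<lambda>c. scl c _"] cong: if_cong)
      finally show ?thesis by simp
    qed
    have spG: "?sp (G x) = ?sp x" for x
    proof (rule antisym; rule span_minimal)
      show "G x ` {1..k} \<subseteq> ?sp x"
        unfolding G_def by (auto intro!: span_sum span_scale intro: span_base)
      show "x ` {1..k} \<subseteq> ?sp (G x)"
      proof (rule image_subsetI)
        fix b assume "b \<in> {1..k}"
        then show "x b \<in> ?sp (G x)"
          by (subst inv) (auto intro!: span_sum span_scale intro: span_base)
      qed
    qed auto
    have Gfr: "G x \<in> frames scl k" if "x \<in> frames scl k" for x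
      unfolding frames_iff
    proof (intro conjI allI impI ballI)
      fix c a assume 0: "(\<Sum>i\<in>{1..k}. scl (c i) (G x i)) = 0" and a: "a \<in> {1..k}"
      have "(\<Sum>i\<in>{1..k}. scl (c i) (G x i)) =
          (\<Sum>i\<in>{1..k}. scl (c i) (\<Sum>b\<in>{1..k}. scl (g i b) (x b)))"
        by (intro sum.cong) (auto simp: G_def)
      also have "\<dots> = (\<Sum>b\<in>{1..k}. scl (\<Sum>i\<in>{1..k}. c i * g i b) (x b))"
        by (rule comb)
      finally have cg: "(\<Sum>i\<in>{1..k}. c i * g i b) = 0" if "b \<in> {1..k}" for b
        using 0 \<open>x \<in> frames scl k\<close> that unfolding frames_iff by auto
      have "c a = (\<Sum>i\<in>{1..k}. c i * (if i = a then 1 else 0))"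
        using a by (simp add: if_distrib cong: if_cong)
      also have "\<dots> = (\<Sum>i\<in>{1..k}. c i * (\<Sum>b\<in>{1..k}. g i b * h b a))"
        using gh a by (intro sum.cong) auto
      also have "\<dots> = (\<Sum>b\<in>{1..k}. (\<Sum>i\<in>{1..k}. c i * g i b) * h b a)"
        by (simp add: sum_distrib_left sum_distrib_right mult.assoc) (rule sum.swap)
      finally show "c a = 0" using cg by simp
    qed (auto simp: G_def)
    have "continuous_map (frame_space k) (frame_space k) G"
      unfolding frame_space_def[of k, THEN arg_cong, of "\<lambda>Y. continuous_map (frame_space k) Y G"]
    proof (intro continuous_map_into_subtopology)
      show "continuous_map (frame_space k) (product_topology (\<lambda>_. vs_topology scl) {1..k}) G"
        unfolding continuous_map_componentwise
      proof (intro conjI ballI)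
        fix a assume a: "a \<in> {1..k}"
        show "continuous_map (frame_space k) (vs_topology scl) (\<lambda>x. G x a)"
          unfolding continuous_into_vs_topology_iff
        proof (intro allI impI)
          fix f assume f: "linear_functional f"
          have "continuous_map (frame_space k) euclidean (\<lambda>x. f (x b))" if "b \<in> {1..k}" for b
            using continuous_map_compose[OF continuous_frame_component[OF that] continuous_linear_functional[OF f]]
            by (simp add: o_def)
          then have "continuous_map (frame_space k) euclidean (\<lambda>x. \<Sum>b\<in>{1..k}. g a b * f (x b))"
            by (intro continuous_map_sum continuous_map_mult_algebra) auto
          then show "continuous_map (frame_space k) euclidean (\<lambda>x. f (G x a))"
            using a f by (simp add: G_def linear_functional_props)
        qed
      qed (auto simp: G_def)
    qed (use Gfr in auto)
    from openin_continuous_map_preimage[OF this U]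
    have "openin (frame_space k) {x \<in> frames scl k. G x \<in> U}"
      unfolding topspace_frame_space .
    moreover have "G w = v"
    proof
      fix a show "G w a = v a"
        using g[of a] v(1) Uf unfolding G_def frames_iff by (cases "a \<in> {1..k}") (auto simp: frames_iff extensional_def)
    qed
    moreover have "{x \<in> frames scl k. G x \<in> U} \<subseteq> P"
      using spG unfolding P_def by (auto simp: image_iff)
    ultimately show ?thesis
      using w v(1) by (intro exI[of _ "{x \<in> frames scl k. G x \<in> U}"]) auto
  qed
  then have "openin (frame_space k) P"
    using openin_subopen by blast
  then show "openin (grassmannian scl k) (?sp ` U)"
    unfolding grassmannian_def frame_space_def[symmetric] openin_quotient_topology topspace_frame_space
    using Uf unfolding P_def by blast
qed

text \<open>Some vector \<open>w\<^sub>j\<close> of the second frame lies outside the span of the first. The family consisting of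
\<open>w\<^sub>j\<close> and the first frame is independent, and it remains so for all frames near the two given ones,
whose spans therefore differ. As spanning is an open map, these neighbourhoods descend to the
Grassmannian.\<close>

lemma grassmannian_separate:
  assumes v: "v \<in> frames scl k" and w: "w \<in> frames scl k"
    and notsub: "\<not> span (w ` {1..k}) \<subseteq> span (v ` {1..k})"
  obtains U U' where "openin (grassmannian scl k) U" "openin (grassmannian scl k) U'"
    "span (v ` {1..k}) \<in> U" "span (w ` {1..k}) \<in> U'" "disjnt U U'"
proof -
  obtain j where j: "j \<in> {1..k}" "w j \<notin> span (v ` {1..k})"
    using notsub span_minimal[of "w ` {1..k}" "span (v ` {1..k})"] subspace_span by blast
  \<comment> \<open>The added vector gets the index 0, which frames leave free.\<close>
  define z where "z = v(0 := w j)"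
  have vz: "v ` {1..k} = z ` {1..k}" by (auto simp: z_def)
  have sum0: "(\<Sum>i\<in>{0..k}. scl (c i) (y i)) = scl (c 0) (y 0) + (\<Sum>i\<in>{1..k}. scl (c i) (y i))"
    for c and y :: "nat \<Rightarrow> 'v"
    by (subst sum.atLeast_Suc_atMost) auto
  have "c i = 0" if 0: "(\<Sum>i\<in>{0..k}. scl (c i) (z i)) = 0" and i: "i \<in> {0..k}" for c i
  proof -
    have eq: "scl (c 0) (w j) = - (\<Sum>i\<in>{1..k}. scl (c i) (v i))"
      using 0 unfolding sum0 by (simp add: z_def eq_neg_iff_add_eq_0)
    have "c 0 = 0"
    proof (rule ccontr)
      assume "c 0 \<noteq> 0"
      then have "w j = scl (inverse (c 0)) (scl (c 0) (w j))" by simp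
      also have "\<dots> \<in> span (v ` {1..k})"
        unfolding eq by (intro span_scale span_neg span_sum span_base imageI)
      finally show False using j by blast
    qed
    moreover from this have "\<forall>i\<in>{1..k}. c i = 0"
      using eq v unfolding frames_iff by auto
    ultimately show ?thesis using i by (cases "i = 0") auto
  qed
  then obtain f where f: "\<And>a. linear_functional (f a)"
    "\<And>a b. a \<in> {0..k} \<Longrightarrow> b \<in> {0..k} \<Longrightarrow> f a (z b) = (if a = b then 1 else 0)"
    using dual_functionals[of z "{0..k}"] by blast
  define near where "near = (\<lambda>a b :: nat. ball (if a = b then 1 else 0 :: complex) (1 / real (card {0..k})))"
  define Q where "Q = {x \<in> frames scl k. \<forall>a\<in>{0..k}. \<forall>b\<in>{1..k}. f a (x b) \<in> near a b}"
  define Q' where "Q' = {x \<in> frames scl k. \<forall>a\<in>{0..k}. f a (x j) \<in> near a 0}"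
  have cont: "openin (frame_space k) {x \<in> frames scl k. f a (x b) \<in> near a c}" if "b \<in> {1..k}" for a b c
  proof -
    have "continuous_map (frame_space k) euclidean (f a \<circ> (\<lambda>x. x b))"
      using continuous_map_compose[OF continuous_frame_component[OF that] continuous_linear_functional[OF f(1)]] .
    then have "openin (frame_space k) {x \<in> topspace (frame_space k). (f a \<circ> (\<lambda>x. x b)) x \<in> near a c}"
      by (rule openin_continuous_map_preimage) (simp add: near_def)
    then show ?thesis
      unfolding topspace_frame_space o_def .
  qed
  have Q_eq: "Q = (\<Inter>a\<in>{0..k}. \<Inter>b\<in>{1..k}. {x \<in> frames scl k. f a (x b) \<in> near a b})"
    and Q'_eq: "Q' = (\<Inter>a\<in>{0..k}. {x \<in> frames scl k. f a (x j) \<in> near a 0})"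
    using j(1) by (auto simp: Q_def Q'_def)
  have "openin (frame_space k) Q"
    unfolding Q_eq using cont j(1) by (intro openin_INT2) auto
  moreover have "openin (frame_space k) Q'"
    unfolding Q'_eq using cont j(1) by (intro openin_INT2) auto
  moreover have "v \<in> Q"
  proof -
    have "f a (v b) = (if a = b then 1 else 0)" if "a \<in> {0..k}" "b \<in> {1..k}" for a b
      using f(2)[of a b] that by (auto simp: z_def split: if_splits)
    then show ?thesis using v by (auto simp: Q_def near_def)
  qed
  moreover have "w \<in> Q'"
  proof -
    have "f a (w j) = (if a = 0 then 1 else 0)" if "a \<in> {0..k}" for a
      using f(2)[of a 0] that by (auto simp: z_def)
    then show ?thesis using w by (auto simp: Q'_def near_def)
  qed
  moreover have "span (x ` {1..k}) \<noteq> span (y ` {1..k})" if "x \<in> Q" "y \<in> Q'" for x y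
  proof
    assume eq: "span (x ` {1..k}) = span (y ` {1..k})"
    have "y j \<in> span (x ` {1..k})"
      unfolding eq using j(1) by (intro span_base imageI)
    then obtain c where c: "y j = (\<Sum>i\<in>{1..k}. scl (c i) (x i))"
      unfolding span_family[OF finite_atLeastAtMost] by blast
    define z' where "z' = x(0 := y j)"
    define c' where "c' = c(0 := - 1)"
    have "c' 0 = 0"
    proof (rule almost_dual_imp_independent[of "{0..k}" f z'])
      have "(\<Sum>i\<in>{1..k}. scl (c' i) (z' i)) = (\<Sum>i\<in>{1..k}. scl (c i) (x i))"
        by (intro sum.cong) (auto simp: c'_def z'_def)
      then show "(\<Sum>b\<in>{0..k}. scl (c' b) (z' b)) = 0"
        unfolding sum0 using c by (simp add: c'_def z'_def)
      fix a b assume a: "a \<in> {0..k}" and b: "b \<in> {0..k}"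
      have "f a (z' b) \<in> near a b"
        using that a b by (cases "b = 0") (auto simp: z'_def Q_def Q'_def)
      then show "cmod (f a (z' b) - (if a = b then 1 else 0)) < 1 / real (card {0..k})"
        unfolding near_def mem_ball by (simp add: dist_norm norm_minus_commute)
    qed (use f in auto)
    then show False by (simp add: c'_def)
  qed
  ultimately show ?thesis
    using open_map_grassmannian[of k] unfolding open_map_def
    by (intro that[of "(\<lambda>v. span (v ` {1..k})) ` Q" "(\<lambda>v. span (v ` {1..k})) ` Q'"])
       (auto simp: disjnt_def)
qed

lemma Hausdorff_grassmannian: "Hausdorff_space (grassmannian scl k)"
  unfolding Hausdorff_space_def
proof (intro allI impI; elim conjE)
  fix S T assume ST: "S \<in> topspace (grassmannian scl k)" "T \<in> topspace (grassmannian scl k)" "S \<noteq> T"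
  then obtain v w where v: "v \<in> frames scl k" "S = span (v ` {1..k})"
      and w: "w \<in> frames scl k" "T = span (w ` {1..k})"
    by (auto simp: topspace_grassmannian)
  from ST(3) consider "\<not> T \<subseteq> S" | "\<not> S \<subseteq> T" by blast
  then show "\<exists>U V. openin (grassmannian scl k) U \<and> openin (grassmannian scl k) V \<and> S \<in> U \<and> T \<in> V \<and> disjnt U V"
  proof cases
    case 1
    then show ?thesis
      using grassmannian_separate[OF v(1) w(1)] v(2) w(2) by metis
  next
    case 2
    then show ?thesis
      using grassmannian_separate[OF w(1) v(1)] v(2) w(2) by (metis disjnt_sym)
  qed
qed

lemma Hausdorff_flag_variety: "Hausdorff_space (flag_variety scl n)"
  unfolding flag_variety_def
  by (intro Hausdorff_space_subtopology)
     (simp add: Hausdorff_space_product_topology Hausdorff_grassmannian)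

end

section \<open>Lines and orthogonal projections in the two-dimensional complex space\<close>

lemma complex_vector_space_cart: "complex_vector_space ((*s) :: complex \<Rightarrow> complex ^ 'n \<Rightarrow> complex ^ 'n)"
  by (simp add: complex_vector_space_def vec.vector_space_axioms)

interpretation cart: complex_vector_space "(*s) :: complex \<Rightarrow> complex ^ 2 \<Rightarrow> complex ^ 2"
  by (rule complex_vector_space_cart)

definition line_of :: "complex ^ 2 \<Rightarrow> (complex ^ 2) set" where
  "line_of u = range (\<lambda>c. c *s u)"

definition herm :: "complex ^ 2 \<Rightarrow> complex ^ 2 \<Rightarrow> complex" where
  "herm u x = cnj (u $ 1) * x $ 1 + cnj (u $ 2) * x $ 2"

definition lines :: "(complex ^ 2) set set" where
  "lines = line_of ` (- {0})"

text \<open>The orthogonal projection to a line. The formula does not depend on the choice of the spanning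
vector, see \<open>proj_line_of\<close>.\<close>

definition proj :: "(complex ^ 2) set \<Rightarrow> complex ^ 2 \<Rightarrow> complex ^ 2" where
  "proj l x = (let u = SOME u. u \<in> l \<and> u \<noteq> 0 in (herm u x / herm u u) *s u)"

lemma mem_line_of: "u \<in> line_of u"
  unfolding line_of_def by (rule range_eqI[of _ _ 1]) simp

lemma herm_self: "herm u u = of_real ((cmod (u $ 1))\<^sup>2 + (cmod (u $ 2))\<^sup>2)"
  unfolding herm_def by (simp add: complex_norm_square mult.commute del: of_real_power)

lemma herm_self_eq_0_iff: "herm u u = 0 \<longleftrightarrow> u = 0"
  unfolding herm_self of_real_eq_0_iff
  by (auto simp: vec_eq_iff forall_2 sum_power2_eq_zero_iff)

lemma proj_line_of:
  assumes "u \<noteq> 0"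
  shows "proj (line_of u) x = (herm u x / herm u u) *s u"
proof -
  define w where "w = (SOME w. w \<in> line_of u \<and> w \<noteq> 0)"
  have "u \<in> line_of u"
    by (rule mem_line_of)
  then have "w \<in> line_of u \<and> w \<noteq> 0"
    unfolding w_def using assms by (intro someI[of "\<lambda>w. w \<in> line_of u \<and> w \<noteq> 0" u]) simp
  then obtain c where c: "w = c *s u" "c \<noteq> 0"
    by (auto simp: line_of_def)
  have "herm w x = cnj c * herm u x" "herm w w = cnj c * c * herm u u"
    unfolding c(1) by (simp_all add: herm_def algebra_simps)
  then have "(herm w x / herm w w) *s w = (herm u x / herm u u) *s u"
    using c(2) by (simp add: c(1))
  then show ?thesis
    by (simp add: proj_def w_def[symmetric])
qed

lemma proj_linear:
  "proj l (x + y) = proj l x + proj l y" "proj l (x - y) = proj l x - proj l y"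
  "proj l (c *s x) = c *s proj l x" "proj l 0 = 0"
proof -
  have herm: "herm u (x + y) = herm u x + herm u y" "herm u (x - y) = herm u x - herm u y"
    "herm u (c *s x) = c * herm u x" "herm u 0 = 0" for u
    by (simp_all add: herm_def algebra_simps)
  show "proj l (x + y) = proj l x + proj l y" "proj l (x - y) = proj l x - proj l y"
    "proj l (c *s x) = c *s proj l x" "proj l 0 = 0"
    unfolding proj_def Let_def herm
    by (simp_all add: add_divide_distrib diff_divide_distrib vec.scale_left_distrib vec.scale_left_diff_distrib)
qed

lemma line_of_iff_proj:
  assumes "l \<in> lines"
  shows "x \<in> l \<longleftrightarrow> proj l x = x"
proof -
  obtain u where u: "u \<noteq> 0" "l = line_of u" using assms by (auto simp: lines_def)
  have "herm u (c *s u) = c * herm u u" for c by (simp add: herm_def algebra_simps)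
  then show ?thesis
    unfolding u(2) proj_line_of[OF u(1)] using u(1)
    by (auto simp: line_of_def herm_self_eq_0_iff image_iff) (metis)
qed

lemma proj_in_line: "l \<in> lines \<Longrightarrow> proj l x \<in> l"
  by (metis (no_types, lifting) ComplD imageE insertI1 line_of_def lines_def proj_line_of rangeI)

lemma proj_idem: "l \<in> lines \<Longrightarrow> proj l (proj l x) = proj l x"
  using line_of_iff_proj proj_in_line by blast

lemma line_multiple:
  assumes "l \<in> lines" "x \<in> l" "x \<noteq> 0" "y \<in> l"
  obtains c where "y = c *s x"
proof -
  obtain u where u: "u \<noteq> 0" "l = line_of u" using assms by (auto simp: lines_def)
  obtain a b where ab: "x = a *s u" "y = b *s u"
    using assms u by (auto simp: line_of_def)
  then have "a \<noteq> 0" using assms by auto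
  then have "y = (b / a) *s x" using ab by simp
  then show ?thesis by (rule that)
qed

lemma line_scale: "l \<in> lines \<Longrightarrow> x \<in> l \<Longrightarrow> c *s x \<in> l"
  by (simp add: line_of_iff_proj proj_linear)

lemma line_eqI:
  assumes "l \<in> lines" "l' \<in> lines" "x \<in> l" "x \<in> l'" "x \<noteq> 0"
  shows "l = l'"
  using assms by (metis line_multiple line_scale subset_antisym subsetI)

lemma line_nonzero:
  assumes "l \<in> lines" obtains u where "u \<in> l" "u \<noteq> 0"
  using assms by (auto simp: lines_def line_of_def) (metis rangeI vec.scale_one)

text \<open>The image of \<open>1 - proj l\<close> is the orthogonal line.\<close>

lemma proj_complement_multiple:
  assumes "l \<in> lines" "x - proj l x \<noteq> 0"
  obtains c where "y - proj l y = c *s (x - proj l x)"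
proof -
  obtain u where u: "u \<noteq> 0" "l = line_of u" using assms by (auto simp: lines_def)
  define w :: "complex ^ 2" where "w = vector [- cnj (u $ 2), cnj (u $ 1)]"
  have *: "z - proj l z = ((u $ 1 * z $ 2 - u $ 2 * z $ 1) / herm u u) *s w" for z
    unfolding u(2) proj_line_of[OF u(1)] using u(1) herm_self_eq_0_iff[of u]
    by (simp add: vec_eq_iff forall_2 w_def field_simps) (simp add: herm_def algebra_simps)
  define a where "a = (u $ 1 * x $ 2 - u $ 2 * x $ 1) / herm u u"
  define b where "b = (u $ 1 * y $ 2 - u $ 2 * y $ 1) / herm u u"
  have x: "x - proj l x = a *s w" and y: "y - proj l y = b *s w"
    unfolding a_def b_def by (rule *)+
  have "a \<noteq> 0" using assms(2) unfolding x by auto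
  then have "y - proj l y = (b / a) *s (x - proj l x)"
    unfolding x y by simp
  then show ?thesis by (rule that)
qed

lemma proj_complement_nonzero:
  assumes "l \<in> lines"
  obtains x where "x - proj l x \<noteq> 0"
proof -
  obtain u where u: "u \<noteq> 0" "l = line_of u" using assms by (auto simp: lines_def)
  define w :: "complex ^ 2" where "w = vector [- cnj (u $ 2), cnj (u $ 1)]"
  have "herm u w = 0" by (simp add: herm_def w_def)
  then have "w - proj l w = w"
    unfolding u(2) proj_line_of[OF u(1)] by simp
  moreover have "w \<noteq> 0" using u(1) by (auto simp: w_def vec_eq_iff forall_2)
  ultimately show ?thesis by (intro that[of w]) simp
qed

section \<open>Topology of the complex projective line\<close>

lemma span_frame_1: "vec.span (v ` {1..1}) = line_of (v 1)" for v :: "nat \<Rightarrow> complex ^ 2"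
proof -
  have "range (\<lambda>c :: nat \<Rightarrow> complex. c 1 *s v 1) = range (\<lambda>c. c *s v 1)"
  proof (rule subset_antisym; rule image_subsetI)
    fix c :: complex
    show "c *s v 1 \<in> range (\<lambda>c :: nat \<Rightarrow> complex. c 1 *s v 1)"
      by (rule range_eqI[of _ _ "\<lambda>_. c"]) simp
  qed (rule rangeI)
  then show ?thesis
    unfolding cart.span_family[OF finite_atLeastAtMost] line_of_def by simp
qed

lemma frames_1: "v \<in> frames ((*s) :: complex \<Rightarrow> complex ^ 2 \<Rightarrow> complex ^ 2) 1 \<longleftrightarrow>
    v \<in> extensional {1} \<and> v 1 \<noteq> 0"
  unfolding cart.frames_iff by (auto dest: spec[of _ "\<lambda>_. 1"])

lemma topspace_projective_line: "topspace projective_line = lines"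
proof -
  have "(\<lambda>v. line_of (v 1)) ` frames (*s) 1 = lines"
  proof (rule subset_antisym; clarify)
    fix v :: "nat \<Rightarrow> complex ^ 2" assume "v \<in> frames (*s) 1"
    then show "line_of (v 1) \<in> lines" by (auto simp: frames_1 lines_def simp del: One_nat_def)
  next
    fix l assume "l \<in> lines"
    then obtain u where "u \<noteq> 0" "l = line_of u" by (auto simp: lines_def)
    then show "l \<in> (\<lambda>v. line_of (v 1)) ` frames (*s) 1"
      by (intro image_eqI[of _ _ "\<lambda>i\<in>{1}. u"]) (auto simp: frames_1 simp del: One_nat_def)
  qed
  then show ?thesis
    unfolding projective_line_def cart.topspace_grassmannian span_frame_1 .
qed

lemma quotient_map_projective_line:
  "quotient_map (cart.frame_space 1) projective_line (\<lambda>v. line_of (v 1))"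
  using cart.quotient_map_grassmannian[of 1]
  unfolding projective_line_def span_frame_1 .

lemma linear_functional_component: "cart.linear_functional (\<lambda>x. x $ i)"
  unfolding cart.linear_functional_def
  by (simp add: Vector_Spaces.linear_iff vec.vector_space_axioms vector_space_over_itself.vector_space_axioms)

lemma continuous_map_divide_field:
  fixes f g :: "'a \<Rightarrow> 'b::real_normed_field"
  assumes "continuous_map X euclidean f" "continuous_map X euclidean g"
    and "\<And>x. x \<in> topspace X \<Longrightarrow> g x \<noteq> 0"
  shows "continuous_map X euclidean (\<lambda>x. f x / g x)"
  using assms by (simp add: continuous_map_atin tendsto_divide)

lemma continuous_map_vec_component:
  assumes "continuous_map X euclidean f"
  shows "continuous_map X euclidean (\<lambda>x. (f x :: complex ^ 2) $ i)"
  using continuous_map_compose[OF assms, of euclidean "\<lambda>x. x $ i"]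
  by (simp add: o_def continuous_on_component continuous_map_iff_continuous2)

lemma continuous_map_vector_scale:
  assumes "continuous_map X euclidean c" "continuous_map X euclidean f"
  shows "continuous_map X euclidean (\<lambda>x. (c x :: complex) *s (f x :: complex ^ 2))"
proof -
  have "continuous_on UNIV (\<lambda>p. fst p *s snd p :: complex ^ 2)"
    unfolding vector_scalar_mult_def
    by (intro continuous_intros)
  then have "continuous_map euclidean euclidean (\<lambda>p. fst p *s snd p :: complex ^ 2)" by simp
  moreover have "continuous_map X euclidean (\<lambda>x. (c x, f x))"
    using continuous_map_pairedI[OF assms] by (simp)
  ultimately have "continuous_map X euclidean ((\<lambda>p. fst p *s snd p) \<circ> (\<lambda>x. (c x, f x)))"
    by (rule continuous_map_compose[rotated])
  then show ?thesis by (simp add: o_def)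
qed

text \<open>Continuity may be tested on spanning vectors, for which the projection is given by an explicit formula.\<close>

lemma continuous_proj_const: "continuous_map projective_line euclidean (\<lambda>l. proj l a)"
proof -
  have comp: "continuous_map (cart.frame_space 1) euclidean (\<lambda>v. v 1 $ i)" for i
    using continuous_map_compose[OF cart.continuous_frame_component
        cart.continuous_linear_functional[OF linear_functional_component], of 1 1 i]
    by (simp add: o_def)
  have v: "continuous_map (cart.frame_space 1) euclidean (\<lambda>v. v 1)"
  proof -
    have "continuous_map (cart.frame_space 1) euclidean (\<lambda>v. v 1 $ 1 *s axis 1 1 + v 1 $ 2 *s axis 2 1 :: complex ^ 2)"
      by (intro continuous_map_add continuous_map_vector_scale comp) auto
    moreover have "v 1 $ 1 *s axis 1 1 + v 1 $ 2 *s axis 2 1 = v 1" for v :: "nat \<Rightarrow> complex ^ 2"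
      by (simp add: vec_eq_iff forall_2 axis_def)
    ultimately show ?thesis by simp
  qed
  have cnj: "continuous_map (cart.frame_space 1) euclidean (\<lambda>v. cnj (v 1 $ i))" for i
    using continuous_map_compose[OF comp, of euclidean cnj]
    by (simp add: o_def continuous_on_cnj)
  have "continuous_map (cart.frame_space 1) euclidean (\<lambda>v. (herm (v 1) a / herm (v 1) (v 1)) *s v 1)"
    unfolding herm_def
    by (intro continuous_map_vector_scale v continuous_map_divide_field continuous_map_add
        continuous_map_mult_algebra comp cnj continuous_map_const[THEN iffD2])
       (auto simp: frames_1 herm_self_eq_0_iff[unfolded herm_def] simp del: One_nat_def)
  then have "continuous_map (cart.frame_space 1) euclidean ((\<lambda>l. proj l a) \<circ> (\<lambda>v. line_of (v 1)))"
    by (rule continuous_map_eq) (simp add: frames_1 proj_line_of del: One_nat_def)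
  then show ?thesis
    by (rule continuous_compose_quotient_map[OF quotient_map_projective_line])
qed

text \<open>On \<open>\<complex>\<^sup>2\<close> the Euclidean topology refines the topology given by linear functionals, because these are
linear combinations of the coordinates.\<close>

lemma continuous_into_projective_line:
  assumes "continuous_map X euclidean f" "\<And>x. x \<in> topspace X \<Longrightarrow> f x \<noteq> 0"
  shows "continuous_map X projective_line (\<lambda>x. line_of (f x))"
proof -
  have "continuous_map X (vs_topology (*s)) f"
    unfolding cart.continuous_into_vs_topology_iff
  proof (intro allI impI)
    fix g :: "complex ^ 2 \<Rightarrow> complex" assume g: "cart.linear_functional g"
    have "g x = x $ 1 * g (axis 1 1) + x $ 2 * g (axis 2 1)" for x
    proof -
      have "x = x $ 1 *s axis 1 1 + x $ 2 *s axis 2 1"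
        by (simp add: vec_eq_iff forall_2 axis_def)
      then show ?thesis
        using cart.linear_functional_props[OF g] by metis
    qed
    moreover have "continuous_map X euclidean (\<lambda>x. f x $ 1 * g (axis 1 1) + f x $ 2 * g (axis 2 1))"
      by (intro continuous_map_add continuous_map_mult_algebra continuous_map_vec_component[OF assms(1)]) auto
    ultimately show "continuous_map X euclidean (\<lambda>x. g (f x))"
      by (metis (no_types, lifting) continuous_map_eq)
  qed
  then have "continuous_map X (cart.frame_space 1) (\<lambda>x. \<lambda>i\<in>{1}. f x)"
    unfolding cart.frame_space_def continuous_map_in_subtopology continuous_map_componentwise
    using assms(2) by (auto simp: frames_1 simp del: One_nat_def)
  then have "continuous_map X projective_line ((\<lambda>v. line_of (v 1)) \<circ> (\<lambda>x. \<lambda>i\<in>{1::nat}. f x))"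
    by (rule continuous_map_compose[OF _ quotient_imp_continuous_map[OF quotient_map_projective_line]])
  then show ?thesis by (simp add: o_def)
qed

lemma compact_projective_line: "compact_space projective_line"
proof -
  have cont: "continuous_map (top_of_set (sphere 0 1)) projective_line line_of"
    by (rule continuous_into_projective_line) auto
  have "line_of ` sphere 0 1 = lines"
  proof (rule subset_antisym; clarify)
    fix u :: "complex ^ 2" assume "u \<in> sphere 0 1"
    then have "u \<noteq> 0" by auto
    then show "line_of u \<in> lines" by (simp add: lines_def)
  next
    fix l assume l: "l \<in> lines"
    then obtain u where u: "u \<in> l" "u \<noteq> 0" by (rule line_nonzero)
    define w where "w = of_real (1 / norm u) *s u"
    have "w = (1 / norm u) *\<^sub>R u"
      unfolding w_def vec_eq_iff vector_scaleR_component vector_smult_component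
      by (simp add: scaleR_conv_of_real)
    then have w: "norm w = 1" using u(2) by simp
    moreover have "w \<in> l" unfolding w_def using l u by (intro line_scale)
    moreover have "w \<in> line_of w" by (rule mem_line_of)
    moreover have "w \<noteq> 0" using w by auto
    moreover from this have "line_of w \<in> lines" by (simp add: lines_def)
    ultimately have "l = line_of w"
      using line_eqI[of l "line_of w" w] l by blast
    moreover have "w \<in> sphere 0 1" using w by simp
    ultimately show "l \<in> line_of ` sphere 0 1" by (rule image_eqI)
  qed
  moreover have "compactin (top_of_set (sphere 0 1)) (sphere 0 1 :: (complex ^ 2) set)"
    by (simp add: compactin_subtopology)
  ultimately show ?thesis
    using image_compactin[OF _ cont] unfolding compact_space_def topspace_projective_line by metis
qed

text \<open>A spanning vector of a line can be moved slightly in a transversal direction, so the projective line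
has no isolated points.\<close>

lemma no_isolated_line:
  assumes U: "openin projective_line U" and l: "l \<in> U"
  obtains l' where "l' \<in> U" "l' \<noteq> m"
proof -
  have "l \<in> lines" using U l openin_subset topspace_projective_line by blast
  then obtain u where u: "u \<noteq> 0" "l = line_of u" by (auto simp: lines_def)
  obtain w where w: "w - proj l w \<noteq> 0"
    using proj_complement_nonzero[OF \<open>l \<in> lines\<close>] .
  have wl: "w \<notin> l" using w line_of_iff_proj[OF \<open>l \<in> lines\<close>] by auto
  define c where "c t = u + of_real t *s w" for t :: real
  have u_l: "u \<in> l" unfolding u(2) line_of_def by (rule range_eqI[of _ _ 1]) simp
  have self: "x \<in> line_of x" for x
    by (rule mem_line_of)
  have notin: "c t \<notin> l" if "t \<noteq> 0" for t
  proof
    assume "c t \<in> l"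
    then have "inverse (of_real t) *s (c t - u) \<in> l"
      using u_l \<open>l \<in> lines\<close> by (simp add: line_of_iff_proj proj_linear)
    then show False using that wl by (simp add: c_def)
  qed
  have c0: "c t \<noteq> 0" for t
    using notin[of t] u(1) line_scale[OF \<open>l \<in> lines\<close> u_l, of 0] by (cases "t = 0") (auto simp: c_def)
  have "continuous_map euclidean projective_line (\<lambda>t. line_of (c t))"
  proof (rule continuous_into_projective_line)
    show "continuous_map euclidean euclidean c"
      unfolding c_def
      by (intro continuous_map_add continuous_map_vector_scale) (auto intro!: continuous_intros)
  qed (rule c0)
  then have "open {t. line_of (c t) \<in> U}"
    using openin_continuous_map_preimage[OF _ U, of euclidean] by simp
  moreover have "0 \<in> {t. line_of (c t) \<in> U}" using l u by (simp add: c_def)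
  ultimately obtain e where e: "e > 0" "\<And>t. \<bar>t\<bar> < e \<Longrightarrow> line_of (c t) \<in> U"
    unfolding open_dist by (auto simp: dist_real_def)
  have "line_of (c (e / 2)) \<noteq> l"
    using notin[of "e / 2"] e self[of "c (e / 2)"] by auto
  then show ?thesis
    using that[of l] that[of "line_of (c (e / 2))"] l e(1) e(2)[of "e / 2"] by fastforce
qed

section \<open>Partial shifts of sequences\<close>

definition is_proj :: "(complex ^ 2 \<Rightarrow> complex ^ 2) \<Rightarrow> bool" where
  "is_proj q \<longleftrightarrow> (\<forall>x y. q (x + y) = q x + q y) \<and> (\<forall>c x. q (c *s x) = c *s q x) \<and> (\<forall>x. q (q x) = q x)"

lemma is_projD:
  assumes "is_proj q"
  shows "q (x + y) = q x + q y" "q (c *s x) = c *s q x" "q (q x) = q x" "q 0 = 0" "q (x - y) = q x - q y"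
proof -
  show a: "q (x + y) = q x + q y" "q (c *s x) = c *s q x" "q (q x) = q x" for x y c
    using assms by (auto simp: is_proj_def)
  show "q 0 = 0" using a(2)[of 0 0] by simp
  show "q (x - y) = q x - q y"
    using a(1)[of "x - y" y] by (simp add: eq_diff_eq)
qed

lemma is_proj_proj: "l \<in> lines \<Longrightarrow> is_proj (proj l)"
  by (simp add: is_proj_def proj_linear proj_idem)

definition compl_proj :: "(complex ^ 2 \<Rightarrow> complex ^ 2) \<Rightarrow> complex ^ 2 \<Rightarrow> complex ^ 2" where
  "compl_proj q x = x - q x"

lemma is_proj_compl: "is_proj q \<Longrightarrow> is_proj (compl_proj q)"
  by (simp add: is_proj_def[of "compl_proj q"] compl_proj_def is_projD vec.scale_right_diff_distrib)

type_synonym seq = "nat \<Rightarrow> complex ^ 2"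

definition shift :: "seq \<Rightarrow> seq" where
  "shift w = (\<lambda>k. w (Suc k))"

lemma shift_power: "(shift ^^ m) w = (\<lambda>k. w (k + m))"
  by (induction m) (auto simp: shift_def)

definition delta :: "complex ^ 2 \<Rightarrow> seq" where
  "delta u = (\<lambda>k. if k = 0 then u else 0)"

definition shift_on :: "(complex ^ 2 \<Rightarrow> complex ^ 2) \<Rightarrow> seq \<Rightarrow> seq" where
  "shift_on q w = (\<lambda>k. q (w (Suc k)) + (w k - q (w k)))"

text \<open>A right inverse of \<open>shift_on q\<close>. It depends on \<open>q\<close> through sums and values of \<open>q\<close> only, and therefore
continuously.\<close>

definition unshift_on :: "(complex ^ 2 \<Rightarrow> complex ^ 2) \<Rightarrow> seq \<Rightarrow> seq" where
  "unshift_on q y = (\<lambda>k. (y k - q (y k)) + (case k of 0 \<Rightarrow> 0 | Suc m \<Rightarrow> q (y m)))"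

text \<open>Apply \<open>q\<close> and \<open>1 - q\<close> to an element of the kernel: every term is in the image of \<open>q\<close>, and every term
but the first is killed by \<open>q\<close>.\<close>

lemma shift_on_kernel:
  assumes "is_proj q"
  shows "shift_on q w = (\<lambda>_. 0) \<longleftrightarrow> (\<exists>u. q u = u \<and> w = delta u)"
proof
  assume 0: "shift_on q w = (\<lambda>_. 0)"
  have eq: "q (w (Suc k)) + (w k - q (w k)) = 0" for k
    using fun_cong[OF 0, of k] by (simp add: shift_on_def)
  have "q (q (w (Suc k)) + (w k - q (w k))) = q (w (Suc k))" for k
    by (simp add: is_projD[OF assms])
  then have q0: "q (w (Suc k)) = 0" for k
    using eq[of k] is_projD(4)[OF assms] by metis
  then have "w k = q (w k)" for k using eq[of k] by simp
  then have "w (Suc k) = 0" for k using q0 by metis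
  then have "w = delta (w 0)"
    by (auto simp: delta_def fun_eq_iff gr0_conv_Suc)
  then show "\<exists>u. q u = u \<and> w = delta u" using \<open>\<And>k. w k = q (w k)\<close> by metis
next
  assume "\<exists>u. q u = u \<and> w = delta u"
  then show "shift_on q w = (\<lambda>_. 0)"
    by (auto simp: shift_on_def delta_def fun_eq_iff is_projD[OF assms])
qed

text \<open>Each of the two operators shifts the part that the other one fixes. So a matched pair of
parentheses acts as the nilpotent map.\<close>

lemma shift_on_compl: "is_proj q \<Longrightarrow> shift_on (compl_proj q) (shift_on q w) = shift w"
  by (simp add: shift_on_def compl_proj_def shift_def is_projD fun_eq_iff)

lemma shift_on_shift: "shift_on q (shift w) = shift (shift_on q w)"
  by (simp add: shift_on_def shift_def)

lemma shift_on_shift_power: "shift_on q ((shift ^^ m) w) = (shift ^^ m) (shift_on q w)"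
  by (induction m) (simp_all add: shift_on_shift)

lemma shift_on_unshift_on: "is_proj q \<Longrightarrow> shift_on q (unshift_on q y) = y"
  by (auto simp: shift_on_def unshift_on_def is_projD fun_eq_iff split: nat.split)

lemma shift_on_add: "is_proj q \<Longrightarrow> shift_on q (\<lambda>k. v k + w k) = (\<lambda>k. shift_on q v k + shift_on q w k)"
  by (simp add: shift_on_def is_projD fun_eq_iff)

lemma shift_on_diff: "is_proj q \<Longrightarrow> shift_on q (\<lambda>k. v k - w k) = (\<lambda>k. shift_on q v k - shift_on q w k)"
  by (simp add: shift_on_def is_projD fun_eq_iff)

lemma shift_on_scale: "is_proj q \<Longrightarrow> shift_on q (\<lambda>k. c *s w k) = (\<lambda>k. c *s shift_on q w k)"
  by (simp add: shift_on_def is_projD fun_eq_iff vec.scale_right_distrib vec.scale_right_diff_distrib)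

definition vanishes_from :: "nat \<Rightarrow> seq \<Rightarrow> bool" where
  "vanishes_from m w \<longleftrightarrow> (\<forall>k\<ge>m. w k = 0)"

lemma vanishes_from_mono: "vanishes_from m w \<Longrightarrow> m \<le> m' \<Longrightarrow> vanishes_from m' w"
  by (simp add: vanishes_from_def)

lemma vanishes_from_shift_on: "is_proj q \<Longrightarrow> vanishes_from m w \<Longrightarrow> vanishes_from m (shift_on q w)"
  by (simp add: vanishes_from_def shift_on_def is_projD)

lemma vanishes_from_unshift_on: "is_proj q \<Longrightarrow> vanishes_from m w \<Longrightarrow> vanishes_from (Suc m) (unshift_on q w)"
  by (auto simp: vanishes_from_def unshift_on_def is_projD split: nat.split)

text \<open>The shift acts on these sequences with Jordan blocks of lengths \<open>a\<close> and \<open>b\<close>.\<close>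

definition two_row_seqs :: "nat \<Rightarrow> nat \<Rightarrow> seq set" where
  "two_row_seqs a b = {w. (\<forall>k\<ge>a. w k $ 1 = 0) \<and> (\<forall>k\<ge>b. w k $ 2 = 0)}"

lemma two_row_seqs_vanishes_from: "w \<in> two_row_seqs a b \<Longrightarrow> b \<le> a \<Longrightarrow> vanishes_from a w"
  by (auto simp: two_row_seqs_def vanishes_from_def vec_eq_iff forall_2)

lemma vanishes_from_two_row_seqs: "vanishes_from b w \<Longrightarrow> b \<le> a \<Longrightarrow> w \<in> two_row_seqs a b"
  by (auto simp: two_row_seqs_def vanishes_from_def)

lemma shift_two_row_seqs: "shift ` two_row_seqs (Suc a) (Suc b) = two_row_seqs a b"
proof (rule subset_antisym; rule subsetI)
  fix w assume w: "w \<in> two_row_seqs a b"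
  show "w \<in> shift ` two_row_seqs (Suc a) (Suc b)"
  proof (rule image_eqI)
    show "w = shift (case_nat 0 w)" by (simp add: shift_def)
    show "case_nat 0 w \<in> two_row_seqs (Suc a) (Suc b)"
      using w by (auto simp: two_row_seqs_def split: nat.split)
  qed
qed (auto simp: two_row_seqs_def shift_def)

section \<open>Open parentheses and the operators they determine\<close>

definition first_line :: "(complex ^ 2) set" where
  "first_line = line_of (axis 1 1)"

lemma first_line: "first_line \<in> lines"
  by (simp add: first_line_def lines_def axis_eq_0_iff)

lemma proj_first_line: "proj first_line x = x $ 1 *s axis 1 1"
proof -
  have "axis 1 1 \<noteq> (0 :: complex ^ 2)" by (simp add: axis_eq_0_iff)
  then show ?thesis
    unfolding first_line_def by (simp add: proj_line_of herm_def axis_def)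
qed

text \<open>The numbers up to \<open>i\<close> that are still unmatched opening parentheses, the latest first. The tail of the
empty list is empty, so that an unmatched closing parenthesis has no effect.\<close>

primrec open_stack :: "nat set \<Rightarrow> nat \<Rightarrow> nat list" where
  "open_stack D 0 = []"
| "open_stack D (Suc i) = (if Suc i \<in> D then Suc i # open_stack D i else tl (open_stack D i))"

primrec shift_stack :: "(nat \<Rightarrow> (complex ^ 2) set) \<Rightarrow> nat list \<Rightarrow> seq \<Rightarrow> seq" where
  "shift_stack l [] w = w"
| "shift_stack l (j # st) w = shift_on (proj (l j)) (shift_stack l st w)"

text \<open>The projection used in the step from \<open>i\<close> to \<open>i + 1\<close>: the chosen line at an opening parenthesis, its
orthogonal complement at the matching closing one, the first axis at an unmatched number.\<close>

definition step_proj :: "nat set \<Rightarrow> (nat \<Rightarrow> (complex ^ 2) set) \<Rightarrow> nat \<Rightarrow> complex ^ 2 \<Rightarrow> complex ^ 2" where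
  "step_proj D l i =
     (if Suc i \<in> D then proj (l (Suc i))
      else case open_stack D i of [] \<Rightarrow> proj first_line | j # _ \<Rightarrow> compl_proj (proj (l j)))"

text \<open>The composition of the first \<open>i\<close> partial shifts. Its kernel is the \<open>i\<close>-th space of the flag.\<close>

primrec shift_steps :: "nat set \<Rightarrow> (nat \<Rightarrow> (complex ^ 2) set) \<Rightarrow> nat \<Rightarrow> seq \<Rightarrow> seq" where
  "shift_steps D l 0 w = w"
| "shift_steps D l (Suc i) w = shift_on (step_proj D l i) (shift_steps D l i w)"

lemma set_open_stack: "set (open_stack D i) \<subseteq> D \<inter> {1..i}"
proof (induction i)
  case (Suc i)
  have "set (tl (open_stack D i)) \<subseteq> set (open_stack D i)"
    by (cases "open_stack D i") auto
  with Suc have "set (tl (open_stack D i)) \<subseteq> D \<inter> {1..Suc i}" "set (open_stack D i) \<subseteq> D \<inter> {1..Suc i}" by auto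
  then show ?case by simp
qed simp

lemma shift_stack_shift_power: "shift_stack l st ((shift ^^ m) w) = (shift ^^ m) (shift_stack l st w)"
  by (induction st) (simp_all add: shift_on_shift_power)

lemma shift_stack_shift: "shift_stack l st (shift w) = shift (shift_stack l st w)"
  using shift_stack_shift_power[of l st 1] by simp

lemma shift_stack_linear:
  assumes "\<forall>j\<in>set st. l j \<in> lines"
  shows "shift_stack l st (\<lambda>k. v k + w k) = (\<lambda>k. shift_stack l st v k + shift_stack l st w k)"
    and "shift_stack l st (\<lambda>k. c *s w k) = (\<lambda>k. c *s shift_stack l st w k)"
  using assms by (induction st) (simp_all add: shift_on_add shift_on_scale is_proj_proj)

lemma shift_stack_vanishes_from:
  assumes "\<forall>j\<in>set st. l j \<in> lines" "vanishes_from m w"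
  shows "vanishes_from m (shift_stack l st w)"
  using assms by (induction st) (simp_all add: vanishes_from_shift_on is_proj_proj)

text \<open>Each partial shift has a right inverse that lengthens a sequence by at most one term.\<close>

lemma shift_stack_lift:
  assumes "\<forall>j\<in>set st. l j \<in> lines" "vanishes_from m w"
  obtains w' where "vanishes_from (m + length st) w'" "shift_stack l st w' = w"
  using assms
proof (induction st arbitrary: m w thesis)
  case Nil
  then show ?case by simp
next
  case (Cons j st)
  have q: "is_proj (proj (l j))" using Cons.prems by (simp add: is_proj_proj)
  have "vanishes_from (Suc m) (unshift_on (proj (l j)) w)"
    using Cons.prems by (intro vanishes_from_unshift_on q) auto
  then obtain w' where "vanishes_from (Suc m + length st) w'" "shift_stack l st w' = unshift_on (proj (l j)) w"
    using Cons.IH[of "Suc m"] Cons.prems by auto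
  then show ?case
    using Cons.prems(1)[of w'] q by (simp add: shift_on_unshift_on)
qed

lemma is_proj_step:
  assumes "l \<in> D \<rightarrow> lines"
  shows "is_proj (step_proj D l i)"
proof (cases "open_stack D i")
  case Nil
  then show ?thesis
    using assms by (auto simp: step_proj_def is_proj_proj first_line Pi_iff)
next
  case (Cons j st)
  then have "j \<in> D" using set_open_stack[of D i] by auto
  with Cons show ?thesis
    using assms by (auto simp: step_proj_def Pi_iff intro: is_proj_proj is_proj_compl)
qed

lemma shift_steps_diff:
  assumes "l \<in> D \<rightarrow> lines"
  shows "shift_steps D l i (\<lambda>k. v k - w k) = (\<lambda>k. shift_steps D l i v k - shift_steps D l i w k)"
  by (induction i) (simp_all add: shift_on_diff is_proj_step[OF assms])

lemma shift_steps_linear: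
  assumes "l \<in> D \<rightarrow> lines"
  shows "shift_steps D l i (\<lambda>k. v k + w k) = (\<lambda>k. shift_steps D l i v k + shift_steps D l i w k)"
    and "shift_steps D l i (\<lambda>k. c *s w k) = (\<lambda>k. c *s shift_steps D l i w k)"
  by (induction i) (simp_all add: shift_on_add shift_on_scale is_proj_step[OF assms])

lemma shift_steps_shift_power: "shift_steps D l i ((shift ^^ m) w) = (shift ^^ m) (shift_steps D l i w)"
  by (induction i) (simp_all add: shift_on_shift_power)

lemma step_proj_cong:
  assumes "\<And>j. j \<in> D \<Longrightarrow> j \<le> Suc i \<Longrightarrow> l j = l' j"
  shows "step_proj D l i = step_proj D l' i"
proof (cases "open_stack D i")
  case Nil
  then show ?thesis
    using assms by (auto simp: step_proj_def)
next
  case (Cons j st)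
  then have "j \<in> D" "j \<le> i" using set_open_stack[of D i] by auto
  with Cons show ?thesis
    using assms by (auto simp: step_proj_def)
qed

lemma shift_steps_cong:
  assumes "\<And>j. j \<in> D \<Longrightarrow> j \<le> i \<Longrightarrow> l j = l' j"
  shows "shift_steps D l i w = shift_steps D l' i w"
  using assms
proof (induction i)
  case (Suc i)
  then have "step_proj D l i = step_proj D l' i" by (intro step_proj_cong) auto
  with Suc show ?case by simp
qed simp

text \<open>The image of the first basis vector under the complementary projections of all open parentheses. This
is the leading term of the image of a long sequence under \<open>shift_stack\<close>; its vanishing is what
makes a flag degenerate.\<close>

fun perp_vec :: "(nat \<Rightarrow> (complex ^ 2) set) \<Rightarrow> nat list \<Rightarrow> complex ^ 2" where
  "perp_vec l [] = axis 1 1"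
| "perp_vec l (j # st) = compl_proj (proj (l j)) (perp_vec l st)"

fun generic_stack :: "(nat \<Rightarrow> (complex ^ 2) set) \<Rightarrow> nat list \<Rightarrow> bool" where
  "generic_stack l [] = True"
| "generic_stack l (j # st) \<longleftrightarrow> l j \<in> lines \<and> perp_vec l st \<notin> l j \<and> generic_stack l st"

lemma perp_vec_nonzero: "generic_stack l st \<Longrightarrow> perp_vec l st \<noteq> 0"
  by (cases st) (auto simp: compl_proj_def axis_eq_0_iff line_of_iff_proj)

lemma shift_stack_peak:
  assumes "\<forall>j\<in>set st. l j \<in> lines"
  shows "shift_stack l st (\<lambda>k. if k = m then axis 1 1 else 0) m = perp_vec l st"
  using assms
proof (induction st)
  case (Cons j st)
  then have q: "is_proj (proj (l j))" by (simp add: is_proj_proj)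
  have "vanishes_from (Suc m) (shift_stack l st (\<lambda>k. if k = m then axis 1 1 else 0))"
    using Cons.prems by (intro shift_stack_vanishes_from) (auto simp: vanishes_from_def)
  then show ?case
    using Cons by (simp add: shift_on_def vanishes_from_def is_projD(4)[OF q] compl_proj_def)
qed simp

lemma not_multipleI:
  assumes "l \<in> lines" "u \<in> l" "u \<noteq> 0" "x \<notin> l"
  shows "u \<noteq> c *s x"
proof
  assume "u = c *s x"
  then have "c \<noteq> 0" using assms by auto
  then have "x = inverse c *s u" using \<open>u = c *s x\<close> by simp
  then show False using line_scale[OF assms(1,2)] assms(4) by metis
qed

text \<open>If the leading term \<open>u\<close> of \<open>shift_on q y\<close>, in position \<open>d\<close>, is not in the image of \<open>1 - q\<close>, then
\<open>y\<close> must be longer by one term, and its leading term is \<open>q u\<close>. By genericity this term is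
again independent of the vector \<open>perp_vec\<close> for the rest of the stack, and the argument can be
repeated until the stack is exhausted.\<close>

lemma generic_stack_top:
  assumes "generic_stack l st" "vanishes_from (Suc d) (shift_stack l st w)"
    and "\<And>c. shift_stack l st w d \<noteq> c *s perp_vec l st"
  shows "w (d + length st) \<noteq> c *s axis 1 1"
  using assms
proof (induction st arbitrary: d)
  case Nil
  then show ?case by simp
next
  case (Cons j st)
  define y where "y = shift_stack l st w"
  define q where "q = proj (l j)"
  have lj: "l j \<in> lines" and x: "perp_vec l st \<notin> l j" using Cons.prems(1) by auto
  have q: "is_proj q" unfolding q_def using lj by (rule is_proj_proj)
  have w: "shift_stack l (j # st) w = shift_on q y" by (simp add: y_def q_def)
  have qw: "q (shift_on q y k) = q (y (Suc k))" "shift_on q y k - q (shift_on q y k) = y k - q (y k)" for k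
    by (simp_all add: shift_on_def is_projD[OF q])
  have van: "shift_on q y k = 0" if "k > d" for k
    using Cons.prems(2) that unfolding w by (simp add: vanishes_from_def)
  have "y k = 0" if k: "k > Suc d" for k
  proof -
    obtain m where m: "k = Suc m" "m > d" using k by (cases k) auto
    have "q (y k) = 0" using qw(1)[of m] van[of m] m is_projD(4)[OF q] by simp
    moreover have "y k - q (y k) = 0" using qw(2)[of k] van[of k] k is_projD(4)[OF q] by simp
    ultimately show ?thesis by simp
  qed
  then have "vanishes_from (Suc (Suc d)) y" by (simp add: vanishes_from_def)
  moreover have "y (Suc d) = q (shift_on q y d)"
    using qw(2)[of "Suc d"] van[of "Suc d"] is_projD(4)[OF q] by (simp add: qw(1))
  moreover have "q (shift_on q y d) \<noteq> 0"
  proof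
    assume "q (shift_on q y d) = 0"
    then have *: "shift_on q y d = shift_on q y d - q (shift_on q y d)" by simp
    obtain c where "shift_on q y d - proj (l j) (shift_on q y d) = c *s (perp_vec l st - proj (l j) (perp_vec l st))"
      using proj_complement_multiple[OF lj, of "perp_vec l st" "shift_on q y d"] x lj
      by (auto simp: line_of_iff_proj)
    then have "shift_on q y d = c *s perp_vec l (j # st)"
      using * by (simp add: q_def compl_proj_def)
    then show False using Cons.prems(3) unfolding w by blast
  qed
  moreover have "q (shift_on q y d) \<in> l j" unfolding q_def using lj by (rule proj_in_line)
  ultimately have "w (Suc d + length st) \<noteq> c *s axis 1 1"
    using Cons.IH[of "Suc d"] Cons.prems(1) not_multipleI[OF lj _ _ x]
    unfolding y_def[symmetric] by (metis generic_stack.simps(2))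
  then show ?case by simp
qed

lemma perp_vec_cong: "(\<And>j. j \<in> set st \<Longrightarrow> l j = l' j) \<Longrightarrow> perp_vec l st = perp_vec l' st"
  by (induction st) simp_all

lemma shift_eq_0_imp_delta: "shift w = (\<lambda>_. 0) \<Longrightarrow> w = delta (w 0)"
  by (auto simp: shift_def delta_def fun_eq_iff gr0_conv_Suc)

primrec unshift_steps :: "nat set \<Rightarrow> (nat \<Rightarrow> (complex ^ 2) set) \<Rightarrow> nat \<Rightarrow> seq \<Rightarrow> seq" where
  "unshift_steps D l 0 y = y"
| "unshift_steps D l (Suc i) y = unshift_steps D l i (unshift_on (step_proj D l i) y)"

lemma shift_steps_unshift_steps:
  assumes "l \<in> D \<rightarrow> lines"
  shows "shift_steps D l i (unshift_steps D l i y) = y"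
  by (induction i arbitrary: y) (simp_all add: shift_on_unshift_on is_proj_step[OF assms])

text \<open>The projection has rank one.\<close>

lemma step_proj_range:
  assumes l: "l \<in> D \<rightarrow> lines"
  shows "\<exists>a. step_proj D l i a \<noteq> 0"
    and "u \<noteq> 0 \<Longrightarrow> step_proj D l i u = u \<Longrightarrow> step_proj D l i y = y \<Longrightarrow> \<exists>c. y = c *s u"
proof -
  consider m where "m \<in> lines" "step_proj D l i = proj m"
    | m where "m \<in> lines" "step_proj D l i = compl_proj (proj m)"
  proof (cases "open_stack D i")
    case Nil
    then show ?thesis using that(1) l first_line by (cases "Suc i \<in> D") (auto simp: step_proj_def Pi_iff)
  next
    case (Cons j st)
    then have "j \<in> D" using set_open_stack[of D i] by auto
    then show ?thesis using Cons that l by (cases "Suc i \<in> D") (auto simp: step_proj_def Pi_iff)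
  qed
  then have "(\<exists>a. step_proj D l i a \<noteq> 0) \<and>
      (u \<noteq> 0 \<longrightarrow> step_proj D l i u = u \<longrightarrow> step_proj D l i y = y \<longrightarrow> (\<exists>c. y = c *s u))"
  proof cases
    case 1
    then show ?thesis
      by (metis line_multiple line_nonzero line_of_iff_proj)
  next
    case 2
    then show ?thesis
      unfolding 2(2) compl_proj_def
      by (metis proj_complement_multiple proj_complement_nonzero)
  qed
  then show "\<exists>a. step_proj D l i a \<noteq> 0"
    and "u \<noteq> 0 \<Longrightarrow> step_proj D l i u = u \<Longrightarrow> step_proj D l i y = y \<Longrightarrow> \<exists>c. y = c *s u"
    by auto
qed

section \<open>Ballot sequences\<close>

text \<open>The set \<open>D\<close> stands for the bottom row of a standard tableau: from every \<open>i\<close> onwards there are at least as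
many numbers in the top row as in the bottom row.\<close>

locale ballot =
  fixes D :: "nat set" and n :: nat
  assumes D_sub: "D \<subseteq> {1..n}"
    and ballot: "\<And>i. i \<le> n \<Longrightarrow> card ({i<..n} \<inter> D) \<le> card ({i<..n} - D)"
begin

definition tops :: "nat \<Rightarrow> nat" where "tops i = card ({i<..n} - D)"
definition bots :: "nat \<Rightarrow> nat" where "bots i = card ({i<..n} \<inter> D)"

lemma counts_Suc:
  assumes "i < n"
  shows "Suc i \<in> D \<Longrightarrow> bots i = Suc (bots (Suc i))" "Suc i \<in> D \<Longrightarrow> tops i = tops (Suc i)"
    "Suc i \<notin> D \<Longrightarrow> bots i = bots (Suc i)" "Suc i \<notin> D \<Longrightarrow> tops i = Suc (tops (Suc i))"
proof -
  have *: "{i<..n} = insert (Suc i) {Suc i<..n}" using assms by auto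
  show "Suc i \<in> D \<Longrightarrow> bots i = Suc (bots (Suc i))" "Suc i \<in> D \<Longrightarrow> tops i = tops (Suc i)"
    "Suc i \<notin> D \<Longrightarrow> bots i = bots (Suc i)" "Suc i \<notin> D \<Longrightarrow> tops i = Suc (tops (Suc i))"
    unfolding bots_def tops_def * by (auto simp: insert_Diff_if Int_insert_left)
qed

text \<open>Every open parenthesis will be closed, and so will the opening ones that are still to come. In
particular no parenthesis remains open at the end.\<close>

lemma stack_bound: "i \<le> n \<Longrightarrow> length (open_stack D i) + bots i \<le> tops i"
proof (induction i)
  case 0
  then show ?case using ballot[of 0] by (simp add: bots_def tops_def)
next
  case (Suc i)
  then have i: "i < n" and IH: "length (open_stack D i) + bots i \<le> tops i" by auto
  have "bots (Suc i) \<le> tops (Suc i)" using ballot[of "Suc i"] i by (simp add: bots_def tops_def)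
  then show ?case
    using IH counts_Suc[OF i] by (cases "open_stack D i") auto
qed

lemma counts_n: "tops n = 0" "bots n = 0"
  by (simp_all add: tops_def bots_def)

lemma open_stack_n: "open_stack D n = []"
  using stack_bound[of n] counts_n by simp

lemma ray_strict:
  assumes "i < n" "Suc i \<notin> D"
  shows "bots i < tops i"
  using counts_Suc[OF assms(1)] assms ballot[of "Suc i"] by (simp add: bots_def tops_def)

text \<open>The image of \<open>V\<close> under the first \<open>i\<close> partial shifts, that is, a model for \<open>V/F\<^sub>i\<close>. For this
reading of the formula see \<open>step_space_step\<close> and \<open>shift_steps_in_step_space_iff\<close>.\<close>

definition step_space :: "(nat \<Rightarrow> (complex ^ 2) set) \<Rightarrow> nat \<Rightarrow> seq set" where
  "step_space l i = shift_stack l (open_stack D i) ` two_row_seqs (tops i) (bots i + length (open_stack D i))"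

text \<open>No chosen line is orthogonal to the line of the innermost enclosing parenthesis, and a line without
enclosing parenthesis differs from the first axis.\<close>

definition generic :: "(nat \<Rightarrow> (complex ^ 2) set) \<Rightarrow> bool" where
  "generic l \<longleftrightarrow> (\<forall>j\<in>D. perp_vec l (open_stack D (j - 1)) \<notin> l j)"

text \<open>The number of the column in which a standard tableau with bottom row \<open>D\<close> contains \<open>i + 1\<close>.\<close>

definition column :: "nat \<Rightarrow> nat" where
  "column i = (if Suc i \<in> D then bots i else tops i)"

context
  fixes l :: "nat \<Rightarrow> (complex ^ 2) set"
  assumes l: "l \<in> D \<rightarrow> lines"
begin

lemma open_stack_lines: "\<forall>j\<in>set (open_stack D i). l j \<in> lines"
  using set_open_stack[of D i] l by (auto simp: Pi_iff)

lemma generic_stack_open_stack: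
  assumes "\<And>j. j \<in> D \<Longrightarrow> j \<le> i \<Longrightarrow> perp_vec l (open_stack D (j - 1)) \<notin> l j"
  shows "generic_stack l (open_stack D i)"
  using assms
proof (induction i)
  case (Suc i)
  have "generic_stack l (open_stack D i)" using Suc by auto
  moreover have "generic_stack l (tl (open_stack D i))" using calculation by (cases "open_stack D i") auto
  ultimately show ?case using l Suc.prems[of "Suc i"] by (auto simp: Pi_iff)
qed simp

lemma step_space_linear:
  assumes "v \<in> step_space l i" "w \<in> step_space l i"
  shows "(\<lambda>k. v k + w k) \<in> step_space l i" "(\<lambda>k. c *s w k) \<in> step_space l i"
proof -
  obtain v' w' where vw: "v = shift_stack l (open_stack D i) v'" "w = shift_stack l (open_stack D i) w'"
      "v' \<in> two_row_seqs (tops i) (bots i + length (open_stack D i))" "w' \<in> two_row_seqs (tops i) (bots i + length (open_stack D i))"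
    using assms by (auto simp: step_space_def)
  have "(\<lambda>k. v k + w k) = shift_stack l (open_stack D i) (\<lambda>k. v' k + w' k)"
    "(\<lambda>k. c *s w k) = shift_stack l (open_stack D i) (\<lambda>k. c *s w' k)"
    unfolding vw(1,2) by (simp_all add: shift_stack_linear[OF open_stack_lines])
  moreover have "(\<lambda>k. v' k + w' k) \<in> two_row_seqs (tops i) (bots i + length (open_stack D i))"
    "(\<lambda>k. c *s w' k) \<in> two_row_seqs (tops i) (bots i + length (open_stack D i))"
    using vw(3,4) by (auto simp: two_row_seqs_def)
  ultimately show "(\<lambda>k. v k + w k) \<in> step_space l i" "(\<lambda>k. c *s w k) \<in> step_space l i"
    unfolding step_space_def by (simp_all only: imageI)
qed

lemma vanishes_from_step_space:
  assumes "i \<le> n" "vanishes_from (bots i) w"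
  shows "w \<in> step_space l i"
proof -
  obtain w' where "vanishes_from (bots i + length (open_stack D i)) w'" "shift_stack l (open_stack D i) w' = w"
    using shift_stack_lift[OF open_stack_lines assms(2)] by blast
  then show ?thesis
    unfolding step_space_def using vanishes_from_two_row_seqs[of "bots i + length (open_stack D i)" w' "tops i"]
      stack_bound[OF assms(1)] by (metis add.commute image_eqI)
qed

lemma step_space_vanishes_from:
  assumes "i \<le> n" "w \<in> step_space l i"
  shows "vanishes_from (tops i) w"
proof -
  obtain w' where w': "w = shift_stack l (open_stack D i) w'" "w' \<in> two_row_seqs (tops i) (bots i + length (open_stack D i))"
    using assms by (auto simp: step_space_def)
  have "vanishes_from (tops i) w'"
    using two_row_seqs_vanishes_from[OF w'(2)] stack_bound[OF assms(1)] by simp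
  then show ?thesis unfolding w'(1) by (intro shift_stack_vanishes_from open_stack_lines)
qed

text \<open>The kernel of the next partial shift lies in the model of \<open>V/F\<^sub>i\<close>, so that the flag does grow in each
step. At an
opening parenthesis all of \<open>\<complex>\<^sup>2\<close> lies in it. At a closing one the vectors orthogonal to the
matching line do: the matching partial shift fixes them, and they can be lifted along the rest of the
stack. At an unmatched number the longer block contains the first axis.\<close>

lemma kernel_in_step_space:
  assumes i: "i < n" and u: "step_proj D l i u = u"
  shows "delta u \<in> step_space l i"
proof (cases "Suc i \<in> D")
  case True
  then show ?thesis
    using i counts_Suc[OF i] by (intro vanishes_from_step_space) (auto simp: vanishes_from_def delta_def)
next
  case False
  show ?thesis
  proof (cases "open_stack D i")
    case Nil
    then have "u = u $ 1 *s axis 1 1"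
      using u False by (simp add: step_proj_def proj_first_line)
    then have "u $ 2 = (u $ 1 *s axis 1 1 :: complex ^ 2) $ 2" by simp
    then have "u $ 2 = 0" by (simp add: axis_def)
    then have "delta u \<in> two_row_seqs (tops i) (bots i)"
      using ray_strict[OF i False] by (auto simp: two_row_seqs_def delta_def)
    then show ?thesis using Nil by (simp add: step_space_def)
  next
    case (Cons j st)
    then have lj: "l j \<in> lines" using open_stack_lines[of i] by simp
    have "proj (l j) u = 0"
      using u False Cons by (simp add: step_proj_def compl_proj_def)
    then have "shift_on (proj (l j)) (delta u) = delta u"
      using is_projD(4)[OF is_proj_proj[OF lj]] by (auto simp: shift_on_def delta_def)
    moreover obtain w' where w': "vanishes_from (Suc (length st)) w'" "shift_stack l st w' = delta u"
      using shift_stack_lift[of st l 1 "delta u"] open_stack_lines[of i] Cons by (auto simp: vanishes_from_def delta_def)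
    ultimately have "shift_stack l (open_stack D i) w' = delta u" using Cons by simp
    moreover have "w' \<in> two_row_seqs (tops i) (bots i + length (open_stack D i))"
      using w'(1) stack_bound[of i] i Cons by (intro vanishes_from_two_row_seqs vanishes_from_mono[OF w'(1)]) auto
    ultimately show ?thesis unfolding step_space_def by (metis image_eqI)
  qed
qed

text \<open>At an opening parenthesis this is the definition. At a matched closing one the top of the stack
and the new operator combine to a shift, which shortens both blocks by one. At an unmatched number
the longer block is shortened.\<close>

lemma step_space_step:
  assumes i: "i < n"
  shows "shift_on (step_proj D l i) ` step_space l i = step_space l (Suc i)"
proof (cases "Suc i \<in> D")
  case True
  then show ?thesis
    using counts_Suc[OF i] by (simp add: step_space_def image_image step_proj_def)
next
  case False
  show ?thesis
  proof (cases "open_stack D i")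
    case Nil
    have "shift_on (proj first_line) ` two_row_seqs (Suc a) b = two_row_seqs a b" for a b
    proof (rule subset_antisym; rule subsetI)
      fix w assume "w \<in> shift_on (proj first_line) ` two_row_seqs (Suc a) b"
      then show "w \<in> two_row_seqs a b"
        by (auto simp: two_row_seqs_def shift_on_def proj_first_line axis_def)
    next
      fix w assume "w \<in> two_row_seqs a b"
      then have "unshift_on (proj first_line) w \<in> two_row_seqs (Suc a) b"
        by (auto simp: two_row_seqs_def unshift_on_def proj_first_line axis_def split: nat.split)
      moreover have "w = shift_on (proj first_line) (unshift_on (proj first_line) w)"
        by (simp add: shift_on_unshift_on is_proj_proj first_line)
      ultimately show "w \<in> shift_on (proj first_line) ` two_row_seqs (Suc a) b" by blast
    qed
    then show ?thesis
      using False Nil counts_Suc[OF i] by (simp add: step_space_def step_proj_def)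
  next
    case (Cons j st)
    then have q: "is_proj (proj (l j))" using open_stack_lines[of i] by (simp add: is_proj_proj)
    have step: "step_proj D l i = compl_proj (proj (l j))"
      using False Cons by (simp add: step_proj_def)
    have "shift_on (step_proj D l i) (shift_stack l (open_stack D i) w) = shift_stack l st (shift w)" for w
      unfolding step Cons shift_stack.simps shift_on_compl[OF q] shift_stack_shift ..
    then have "shift_on (step_proj D l i) ` step_space l i =
        (\<lambda>w. shift_stack l st (shift w)) ` two_row_seqs (Suc (tops (Suc i))) (Suc (bots (Suc i) + length st))"
      using counts_Suc[OF i] False unfolding step_space_def image_image by (simp add: Cons)
    also have "\<dots> = shift_stack l st ` two_row_seqs (tops (Suc i)) (bots (Suc i) + length st)"
      by (simp only: image_image[of "shift_stack l st" shift, symmetric] shift_two_row_seqs)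
    finally show ?thesis using False Cons by (simp add: step_space_def)
  qed
qed

text \<open>Membership can be tested after any number of steps because the kernels of the partial shifts are
contained in the spaces to which they are applied.\<close>

lemma shift_steps_in_step_space_iff:
  "i \<le> n \<Longrightarrow> shift_steps D l i w \<in> step_space l i \<longleftrightarrow> w \<in> two_row_seqs (tops 0) (bots 0)"
proof (induction i)
  case 0
  then show ?case by (simp add: step_space_def)
next
  case (Suc i)
  then have i: "i < n" by simp
  let ?q = "step_proj D l i"
  have q: "is_proj ?q" using l by (rule is_proj_step)
  have "shift_on ?q y \<in> shift_on ?q ` step_space l i \<longleftrightarrow> y \<in> step_space l i" for y
  proof
    assume "shift_on ?q y \<in> shift_on ?q ` step_space l i"
    then obtain z where z: "z \<in> step_space l i" "shift_on ?q y = shift_on ?q z" by auto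
    have "shift_on ?q (\<lambda>k. y k - z k) = (\<lambda>_. 0)"
      unfolding shift_on_diff[OF q] z(2) by simp
    then obtain u where u: "?q u = u" "(\<lambda>k. y k - z k) = delta u"
      using shift_on_kernel[OF q] by blast
    have "y = (\<lambda>k. z k + delta u k)"
      unfolding u(2)[symmetric] by simp
    then show "y \<in> step_space l i"
      using step_space_linear(1)[OF z(1) kernel_in_step_space[OF i u(1)]] by simp
  qed auto
  then show ?case
    using Suc.IH i unfolding step_space_step[OF i, symmetric] by simp
qed

lemma step_space_n: "step_space l n = {\<lambda>_. 0}"
proof -
  have "two_row_seqs 0 0 = {\<lambda>_. 0}"
    by (auto simp: two_row_seqs_def vec_eq_iff forall_2 fun_eq_iff)
  then show ?thesis by (simp add: step_space_def open_stack_n counts_n)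
qed

lemma kernel_shift_steps_n: "shift_steps D l n w = (\<lambda>_. 0) \<longleftrightarrow> w \<in> two_row_seqs (tops 0) (bots 0)"
  using shift_steps_in_step_space_iff[of n w] by (simp add: step_space_n)

text \<open>A sequence \<open>w\<close> whose shift by \<open>tops i - 1\<close> is \<open>delta u\<close> has \<open>u\<close> as its last possible term. If \<open>w\<close> is the
  image of a sequence of the same length under \<open>shift_on q\<close>, this last term is not affected by the shifted
  part and lies in the image of \<open>1 - q\<close>. If the stack is empty, the second block is shorter than
  \<open>tops i\<close> and \<open>u\<close> is on the first axis.\<close>

lemma top_forced:
  assumes i: "i < n" and top: "Suc i \<notin> D" and u: "delta u \<in> (shift ^^ (tops i - 1)) ` step_space l i"
  shows "step_proj D l i u = u"
proof -
  obtain w where w: "w \<in> step_space l i" "delta u = (shift ^^ (tops i - 1)) w" using u by auto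
  have t: "tops i > 0" using ray_strict[OF i top] by simp
  have u_eq: "u = w (tops i - 1)"
    using fun_cong[OF w(2), of 0] by (simp add: shift_power delta_def)
  obtain w' where w': "w = shift_stack l (open_stack D i) w'" "w' \<in> two_row_seqs (tops i) (bots i + length (open_stack D i))"
    using w(1) by (auto simp: step_space_def)
  show ?thesis
  proof (cases "open_stack D i")
    case Nil
    then have "u $ 2 = 0"
      using ray_strict[OF i top] w' by (auto simp: u_eq two_row_seqs_def)
    then have "u = u $ 1 *s axis 1 1"
      by (simp add: vec_eq_iff forall_2 axis_def)
    then show ?thesis
      using Nil top by (simp add: step_proj_def proj_first_line)
  next
    case (Cons j st)
    then have q: "is_proj (proj (l j))" using open_stack_lines[of i] by (simp add: is_proj_proj)
    have "vanishes_from (tops i) w'"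
      using two_row_seqs_vanishes_from[OF w'(2)] stack_bound[of i] i by simp
    then have "vanishes_from (tops i) (shift_stack l st w')"
      using open_stack_lines[of i] Cons by (intro shift_stack_vanishes_from) auto
    then have "shift_stack l st w' (Suc (tops i - 1)) = 0"
      using t by (simp add: vanishes_from_def)
    then have "u = shift_stack l st w' (tops i - 1) - proj (l j) (shift_stack l st w' (tops i - 1))"
      unfolding u_eq w'(1) Cons by (simp add: shift_on_def is_projD(4)[OF q])
    then have "proj (l j) u = 0" by (simp add: is_projD[OF q])
    then show ?thesis using Cons top by (simp add: step_proj_def compl_proj_def)
  qed
qed

text \<open>The line \<open>F\<^sub>i\<^sub>+\<^sub>1/F\<^sub>i\<close> satisfies the conditions that define \<open>SV(A)\<close>. At a number in the top row,
\<open>perp_vec\<close> is a nonzero vector in the image of the highest possible power of the shift, and it spans the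
line. At a number in the bottom row, the first condition holds for all vectors; the second one holds
because a vector in the smaller image would be the last term of a sequence whose preimage under
\<open>shift_stack\<close>, by \<open>generic_stack_top\<close>, is longer than the second block allows.\<close>

lemma generic_column:
  assumes gen: "generic l" and i: "i < n" and u: "step_proj D l i u = u"
  shows "delta u \<in> (shift ^^ (column i - 1)) ` step_space l i"
    and "u \<noteq> 0 \<Longrightarrow> delta u \<notin> (shift ^^ column i) ` step_space l i"
proof -
  have gs: "generic_stack l (open_stack D i)"
    using gen by (intro generic_stack_open_stack) (auto simp: generic_def)
  let ?x = "perp_vec l (open_stack D i)"
  show "delta u \<in> (shift ^^ (column i - 1)) ` step_space l i"
  proof (cases "Suc i \<in> D")
    case True
    then have col: "column i = bots i" "bots i > 0"
      using counts_Suc[OF i] by (simp_all add: column_def)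
    define w where "w = (\<lambda>k. if k = bots i - 1 then u else 0)"
    have "w \<in> step_space l i"
      using i col(2) by (intro vanishes_from_step_space) (auto simp: w_def vanishes_from_def)
    moreover have "delta u = (shift ^^ (column i - 1)) w"
      by (auto simp: shift_power col(1) w_def delta_def)
    ultimately show ?thesis by blast
  next
    case False
    have col: "column i = tops i" "tops i > 0"
      using ray_strict[OF i False] False by (simp_all add: column_def)
    define m where "m = tops i - 1"
    define w where "w = shift_stack l (open_stack D i) (\<lambda>k. if k = m then axis 1 1 else 0)"
    have "(\<lambda>k. if k = m then axis 1 1 else 0) \<in> two_row_seqs (tops i) (bots i + length (open_stack D i))"
      using col(2) by (auto simp: two_row_seqs_def m_def axis_def)
    then have w: "w \<in> step_space l i" unfolding w_def step_space_def by (rule imageI)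
    have "vanishes_from (Suc m) w"
      using step_space_vanishes_from[OF _ w] i col(2) by (simp add: m_def)
    then have dx: "(shift ^^ m) w = delta ?x"
      using shift_stack_peak[OF open_stack_lines, of i m]
      by (auto simp: shift_power delta_def w_def[symmetric] vanishes_from_def fun_eq_iff)
    then have x: "step_proj D l i ?x = ?x"
      using w by (intro top_forced[OF i False]) (metis image_eqI m_def)
    obtain c where c: "u = c *s ?x"
    proof (cases "open_stack D i")
      case Nil
      then have "u = u $ 1 *s ?x"
        using u False by (simp add: step_proj_def proj_first_line)
      then show ?thesis by (rule that)
    next
      case (Cons j st)
      then have lj: "l j \<in> lines" using open_stack_lines[of i] by simp
      have eq: "step_proj D l i y = y - proj (l j) y" for y
        using False Cons by (simp add: step_proj_def compl_proj_def)
      obtain c where "u - proj (l j) u = c *s (?x - proj (l j) ?x)"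
        using proj_complement_multiple[OF lj, of ?x u] x perp_vec_nonzero[OF gs] unfolding eq by metis
      then have "u = c *s ?x" using u x unfolding eq by metis
      then show ?thesis by (rule that)
    qed
    have m: "column i - 1 = m" by (simp add: col(1) m_def)
    have "delta u = (shift ^^ (column i - 1)) (\<lambda>k. c *s w k)"
      unfolding m using fun_cong[OF dx] by (auto simp: shift_power c delta_def fun_eq_iff)
    then show ?thesis
      using step_space_linear(2)[OF w w] by (rule image_eqI)
  qed
  show "delta u \<notin> (shift ^^ column i) ` step_space l i" if "u \<noteq> 0"
  proof
    assume "delta u \<in> (shift ^^ column i) ` step_space l i"
    then obtain w where w: "w \<in> step_space l i" "delta u = (shift ^^ column i) w" by auto
    have wk: "w (k + column i) = delta u k" for k
      using fun_cong[OF w(2), of k] by (simp add: shift_power)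
    show False
    proof (cases "Suc i \<in> D")
      case False
      then show False
        using wk[of 0] step_space_vanishes_from[OF _ w(1)] i that by (simp add: column_def vanishes_from_def delta_def)
    next
      case True
      have col: "column i = bots i" using True by (simp add: column_def)
      obtain w' where w': "w = shift_stack l (open_stack D i) w'" "w' \<in> two_row_seqs (tops i) (bots i + length (open_stack D i))"
        using w(1) by (auto simp: step_space_def)
      have "w k = 0" if "k \<ge> Suc (bots i)" for k
        using wk[of "k - bots i"] that by (simp add: col delta_def)
      then have van: "vanishes_from (Suc (bots i)) (shift_stack l (open_stack D i) w')"
        unfolding w'(1)[symmetric] by (simp add: vanishes_from_def)
      have "u \<in> l (Suc i)"
        using u True Pi_mem[OF l True] by (simp add: step_proj_def line_of_iff_proj)
      moreover have "?x \<notin> l (Suc i)"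
        using bspec[OF gen[unfolded generic_def] True] by simp
      ultimately have "u \<noteq> c *s ?x" for c
        using not_multipleI[OF Pi_mem[OF l True] _ that] by blast
      then have "shift_stack l (open_stack D i) w' (bots i) \<noteq> c *s ?x" for c
        unfolding w'(1)[symmetric] using wk[of 0] by (simp add: col delta_def)
      with van have *: "w' (bots i + length (open_stack D i)) \<noteq> c *s axis 1 1" for c
        using generic_stack_top[OF gs] by blast
      have "w' (bots i + length (open_stack D i)) $ 2 = 0"
        using w'(2) by (simp add: two_row_seqs_def)
      then have "w' (bots i + length (open_stack D i)) = w' (bots i + length (open_stack D i)) $ 1 *s axis 1 1"
        by (simp add: vec_eq_iff forall_2 axis_def)
      then show False using * by blast
    qed
  qed
qed

end

end

section \<open>Continuous dependence on the lines\<close>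

lemma continuous_proj:
  assumes "continuous_map Z projective_line L" "continuous_map Z euclidean x"
  shows "continuous_map Z euclidean (\<lambda>z. proj (L z) (x z))"
proof -
  have eq: "proj (L z) (x z) = x z $ 1 *s proj (L z) (axis 1 1) + x z $ 2 *s proj (L z) (axis 2 1)" for z
  proof -
    have "x z = x z $ 1 *s axis 1 1 + x z $ 2 *s axis 2 1"
      by (simp add: vec_eq_iff forall_2 axis_def)
    then have "proj (L z) (x z) = proj (L z) (x z $ 1 *s axis 1 1 + x z $ 2 *s axis 2 1)" by simp
    then show ?thesis by (simp only: proj_linear)
  qed
  have "continuous_map Z euclidean (\<lambda>z. proj (L z) a)" for a
    using continuous_map_compose[OF assms(1) continuous_proj_const[of a]] by (simp add: o_def)
  then show ?thesis
    unfolding eq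
    by (intro continuous_map_add continuous_map_vector_scale continuous_map_vec_component[OF assms(2)])
qed

lemma continuous_step_proj:
  assumes L: "\<And>j. j \<in> D \<Longrightarrow> continuous_map Z projective_line (\<lambda>z. L z j)"
    and x: "continuous_map Z euclidean x"
  shows "continuous_map Z euclidean (\<lambda>z. step_proj D (L z) i (x z))"
proof (cases "Suc i \<in> D")
  case True
  then show ?thesis using assms by (simp add: step_proj_def continuous_proj)
next
  case False
  show ?thesis
  proof (cases "open_stack D i")
    case Nil
    have "continuous_map Z projective_line (\<lambda>_. first_line)"
      by (simp add: topspace_projective_line first_line)
    with False Nil show ?thesis by (simp add: step_proj_def continuous_proj x)
  next
    case (Cons j st)
    then have "j \<in> D" using set_open_stack[of D i] by auto
    with False Cons show ?thesis
      by (simp add: step_proj_def compl_proj_def continuous_map_diff continuous_proj L x)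
  qed
qed

lemma continuous_unshift_steps:
  assumes L: "\<And>j. j \<in> D \<Longrightarrow> continuous_map Z projective_line (\<lambda>z. L z j)"
    and y: "\<And>k. continuous_map Z euclidean (\<lambda>z. y z k)"
  shows "continuous_map Z euclidean (\<lambda>z. unshift_steps D (L z) i (y z) k)"
  using y
proof (induction i arbitrary: y k)
  case (Suc i)
  have "continuous_map Z euclidean (\<lambda>z. unshift_on (step_proj D (L z) i) (y z) k)" for k
    unfolding unshift_on_def
    using Suc.prems continuous_step_proj[OF L, where x = "\<lambda>z. y z _"]
    by (cases k) (auto intro!: continuous_map_add continuous_map_diff)
  then show ?case by (simp add: Suc.IH)
qed simp

section \<open>The flags determined by lines\<close>

lemma induced_map_coset:
  assumes "Vector_Spaces.linear scl scl N" "module.subspace scl W" "N ` W \<subseteq> W"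
  shows "induced_map N W (v +o W) = N v +o W"
    and "(induced_map N W ^^ k) (v +o W) = (N ^^ k) v +o W"
proof -
  interpret N: Vector_Spaces.linear scl scl N by fact
  have add: "x + y \<in> W" if "x \<in> W" "y \<in> W" for x y
    using N.vs1.subspace_add[OF assms(2)] that by blast
  have zero: "0 \<in> W" using N.vs1.subspace_0[OF assms(2)] .
  have "induced_map N W (v +o W) = N v +o W" for v
  proof (rule subset_antisym; rule subsetI)
    fix x assume "x \<in> induced_map N W (v +o W)"
    then obtain w w' where "w \<in> W" "w' \<in> W" "x = N (v + w) + w'"
      by (auto simp: induced_map_def set_plus_def elt_set_plus_def)
    then have "x = N v + (N w + w')" "N w + w' \<in> W"
      using assms(3) add by (auto simp: N.add add.assoc)
    then show "x \<in> N v +o W" by (auto simp: elt_set_plus_def)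
  next
    fix x assume "x \<in> N v +o W"
    then obtain w where "w \<in> W" "x = N v + w" by (auto simp: elt_set_plus_def)
    moreover have "N v \<in> N ` (v +o W)"
      using zero by (intro imageI) (auto simp: elt_set_plus_def intro: bexI[of _ 0])
    ultimately show "x \<in> induced_map N W (v +o W)"
      unfolding induced_map_def by (metis set_plus_intro)
  qed
  then show "induced_map N W (v +o W) = N v +o W"
    and "(induced_map N W ^^ k) (v +o W) = (N ^^ k) v +o W"
    by (induction k) simp_all
qed

text \<open>The map \<open>coords\<close> identifies \<open>V\<close> with the sequences for two Jordan blocks, \<open>N\<close> with the shift, and
\<open>vec_of\<close> is the inverse of \<open>coords\<close>. As only finitely many terms of a sequence matter to \<open>vec_of\<close>, it
preserves termwise continuity; this is demanded for families indexed by the choices of lines.\<close>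

locale two_row_nilpotent = complex_vector_space scl + ballot D n +
    finite_dimensional_vector_space scl basis
  for scl :: "complex \<Rightarrow> 'v::ab_group_add \<Rightarrow> 'v" and D n and basis :: "'v set" +
  fixes N :: "'v \<Rightarrow> 'v" and coords :: "'v \<Rightarrow> seq" and vec_of :: "seq \<Rightarrow> 'v"
  assumes dim_UNIV: "dim UNIV = n"
    and N_linear: "Vector_Spaces.linear scl scl N"
    and coords_add: "coords (x + y) = (\<lambda>k. coords x k + coords y k)"
    and coords_scale: "coords (scl c x) = (\<lambda>k. c *s coords x k)"
    and vec_of_coords: "vec_of (coords v) = v"
    and coords_two_row_seqs: "coords v \<in> two_row_seqs (tops 0) (bots 0)"
    and coords_vec_of: "w \<in> two_row_seqs (tops 0) (bots 0) \<Longrightarrow> coords (vec_of w) = w"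
    and coords_N: "coords (N v) = shift (coords v)"
    and vec_of_continuous: "(\<And>k. continuous_map Z euclidean (\<lambda>z. s z k)) \<Longrightarrow>
          continuous_map Z (vs_topology scl) (\<lambda>z :: nat \<Rightarrow> (complex ^ 2) set. vec_of (s z))"
begin

definition flag_of :: "(nat \<Rightarrow> (complex ^ 2) set) \<Rightarrow> nat \<Rightarrow> 'v set" where
  "flag_of l = (\<lambda>i\<in>{0..n}. {v. shift_steps D l i (coords v) = (\<lambda>_. 0)})"

text \<open>The set \<open>SV(A)\<close>, with the columns of \<open>A\<close> expressed by its bottom row.\<close>

definition tableau_cell :: "(nat \<Rightarrow> 'v set) set" where
  "tableau_cell = {F \<in> springer_fiber scl n N. \<forall>i\<in>{1..n}.
     quot_by (F (i - 1)) (F i) \<subseteq>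
       induced_kernel N (F (i - 1)) \<inter> induced_image_power N (F (i - 1)) (column (i - 1) - 1) \<and>
     \<not> quot_by (F (i - 1)) (F i) \<subseteq> induced_image_power N (F (i - 1)) (column (i - 1))}"

text \<open>A vector that spans the flag in step \<open>i + 1\<close> modulo the previous space.\<close>

definition step_vector :: "(nat \<Rightarrow> (complex ^ 2) set) \<Rightarrow> nat \<Rightarrow> complex ^ 2 \<Rightarrow> 'v" where
  "step_vector l i u = vec_of (unshift_steps D l i (delta u))"

abbreviation line_space :: "(nat \<Rightarrow> (complex ^ 2) set) topology" where
  "line_space \<equiv> product_topology (\<lambda>_. projective_line) D"

lemma coords_0: "coords 0 = (\<lambda>_. 0)"
  using coords_scale[of 0 0] by simp

lemma coords_eq_0_iff: "coords v = (\<lambda>_. 0) \<longleftrightarrow> v = 0"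
  using vec_of_coords coords_0 by metis

lemma coords_diff: "coords (x - y) = (\<lambda>k. coords x k - coords y k)"
proof
  fix k
  have "coords x k = coords (x - y) k + coords y k"
    using coords_add[of "x - y" y] by (simp add: fun_eq_iff)
  then show "coords (x - y) k = coords x k - coords y k" by simp
qed

lemma coords_N_power: "coords ((N ^^ k) v) = (shift ^^ k) (coords v)"
  by (induction k) (simp_all add: coords_N)

context
  fixes l assumes l: "l \<in> D \<rightarrow> lines"
begin

lemma mem_flag_of: "i \<le> n \<Longrightarrow> v \<in> flag_of l i \<longleftrightarrow> shift_steps D l i (coords v) = (\<lambda>_. 0)"
  by (simp add: flag_of_def)

lemma subspace_flag_of: "i \<le> n \<Longrightarrow> subspace (flag_of l i)"
  unfolding subspace_def
  using shift_steps_linear(2)[OF l, of i 0 "\<lambda>_. 0"]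
  by (simp add: mem_flag_of coords_0 coords_add coords_scale shift_steps_linear[OF l])

lemma mem_flag_of_Suc:
  assumes "i < n"
  shows "v \<in> flag_of l (Suc i) \<longleftrightarrow> (\<exists>u. step_proj D l i u = u \<and> shift_steps D l i (coords v) = delta u)"
  using assms by (simp add: mem_flag_of shift_on_kernel is_proj_step[OF l])

lemma shift_steps_step_vector:
  assumes "i < n" "step_proj D l i u = u"
  shows "shift_steps D l i (coords (step_vector l i u)) = delta u"
proof -
  have "shift_steps D l i (unshift_steps D l i (delta u)) \<in> step_space l i"
    unfolding shift_steps_unshift_steps[OF l] using l assms by (rule kernel_in_step_space)
  then have "unshift_steps D l i (delta u) \<in> two_row_seqs (tops 0) (bots 0)"
    using shift_steps_in_step_space_iff[OF l, of i] assms by simp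
  then show ?thesis
    unfolding step_vector_def by (simp add: coords_vec_of shift_steps_unshift_steps[OF l])
qed

lemma step_vector_in_flag_of:
  assumes "i < n" "step_proj D l i u = u" "u \<noteq> 0"
  shows "step_vector l i u \<in> flag_of l (Suc i)" "step_vector l i u \<notin> flag_of l i"
proof -
  show "step_vector l i u \<in> flag_of l (Suc i)"
    using shift_steps_step_vector[OF assms(1,2)] assms by (auto simp: mem_flag_of_Suc)
  have "delta u \<noteq> (\<lambda>_. 0)" using assms(3) by (auto simp: delta_def fun_eq_iff)
  then show "step_vector l i u \<notin> flag_of l i"
    using shift_steps_step_vector[OF assms(1,2)] assms by (simp add: mem_flag_of)
qed

lemma flag_of_mono: "i < n \<Longrightarrow> flag_of l i \<subseteq> flag_of l (Suc i)"
proof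
  fix v assume "i < n" "v \<in> flag_of l i"
  then show "v \<in> flag_of l (Suc i)"
    using is_projD(4)[OF is_proj_step[OF l, of i]] by (simp add: mem_flag_of shift_on_def)
qed

lemma flag_of_strict: "i < n \<Longrightarrow> flag_of l i \<subset> flag_of l (Suc i)"
proof -
  assume i: "i < n"
  obtain a where a: "step_proj D l i a \<noteq> 0" using step_proj_range(1)[OF l, where i = i] by auto
  then show ?thesis
    using step_vector_in_flag_of[OF i, of "step_proj D l i a"] flag_of_mono[OF i] is_projD(3)[OF is_proj_step[OF l]]
    by blast
qed

lemma N_flag_of: "i < n \<Longrightarrow> v \<in> flag_of l (Suc i) \<Longrightarrow> N v \<in> flag_of l i"
proof -
  assume i: "i < n" and "v \<in> flag_of l (Suc i)"
  then obtain u where "shift_steps D l i (coords v) = delta u"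
    using mem_flag_of_Suc by blast
  then show "N v \<in> flag_of l i"
    using shift_steps_shift_power[of D l i 1 "coords v"] i
    by (simp add: mem_flag_of coords_N) (simp add: shift_def delta_def)
qed

lemma flag_of_springer: "flag_of l \<in> springer_fiber scl n N"
proof -
  have "flag_of l n = UNIV"
    using kernel_shift_steps_n[OF l] coords_two_row_seqs by (simp add: flag_of_def)
  moreover have "flag_of l 0 = {0}"
    by (auto simp: flag_of_def coords_eq_0_iff)
  ultimately have "flag_of l \<in> complete_flags scl n"
    using flag_of_strict subspace_flag_of by (auto simp: complete_flags_def) (auto simp: flag_of_def)
  moreover have "N ` flag_of l i \<subseteq> flag_of l (i - 1)" if "i \<in> {1..n}" for i
  proof clarify
    fix v assume "v \<in> flag_of l i"
    then show "N v \<in> flag_of l (i - 1)"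
      using N_flag_of[of "i - 1"] that by auto
  qed
  ultimately show ?thesis by (simp add: springer_fiber_def)
qed

text \<open>A basis adapted to the flag, obtained by lifting a spanning vector of each one-dimensional kernel.
Through such bases the flag depends continuously on the lines.\<close>

lemma flag_frame:
  assumes u: "\<And>j. j < n \<Longrightarrow> step_proj D l j (u j) = u j" "\<And>j. j < n \<Longrightarrow> u j \<noteq> 0" and i: "i \<le> n"
  shows "(\<lambda>j\<in>{1..i}. step_vector l (j - 1) (u (j - 1))) \<in> frames scl i"
    and "span ((\<lambda>j\<in>{1..i}. step_vector l (j - 1) (u (j - 1))) ` {1..i}) = flag_of l i"
proof -
  define v where "v j = step_vector l (j - 1) (u (j - 1))" for j
  have vv: "(\<Sum>j\<in>{1..i}. scl (c j) ((\<lambda>j\<in>{1..i}. v j) j)) = (\<Sum>j\<in>{1..i}. scl (c j) (v j))" for c i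
    by (intro sum.cong) auto
  have im: "(\<lambda>j\<in>{1..i}. v j) ` {1..i} = v ` {1..i}" for i
    by (intro image_cong) auto
  have "(\<forall>c. (\<Sum>j\<in>{1..i}. scl (c j) (v j)) = 0 \<longrightarrow> (\<forall>j\<in>{1..i}. c j = 0)) \<and> span (v ` {1..i}) = flag_of l i"
    using i
  proof (induction i)
    case 0
    have "flag_of l 0 = {0}" by (auto simp: mem_flag_of coords_eq_0_iff)
    then show ?case by simp
  next
    case (Suc i)
    then have i: "i < n" and ind: "\<And>c. (\<Sum>j\<in>{1..i}. scl (c j) (v j)) = 0 \<Longrightarrow> (\<forall>j\<in>{1..i}. c j = 0)"
      and sp: "span (v ` {1..i}) = flag_of l i" by auto
    have v: "v (Suc i) \<in> flag_of l (Suc i)" "v (Suc i) \<notin> flag_of l i"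
      using step_vector_in_flag_of[OF i u(1)[OF i] u(2)[OF i]] by (simp_all add: v_def)
    have ins: "{1..Suc i} = insert (Suc i) {1..i}" by auto
    have "\<forall>j\<in>{1..Suc i}. c j = 0" if 0: "(\<Sum>j\<in>{1..Suc i}. scl (c j) (v j)) = 0" for c
    proof -
      have eq: "scl (c (Suc i)) (v (Suc i)) = - (\<Sum>j\<in>{1..i}. scl (c j) (v j))"
        using 0 by (simp add: ins eq_neg_iff_add_eq_0 add.commute)
      have "c (Suc i) = 0"
      proof (rule ccontr)
        assume c: "c (Suc i) \<noteq> 0"
        have "scl (c (Suc i)) (v (Suc i)) \<in> flag_of l i"
          unfolding eq sp[symmetric] by (intro span_neg span_sum span_scale span_base imageI)
        then have "scl (inverse (c (Suc i))) (scl (c (Suc i)) (v (Suc i))) \<in> flag_of l i"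
          using subspace_scale[OF subspace_flag_of] i by (metis less_imp_le)
        then show False using v c by simp
      qed
      with ind[of c] eq show ?thesis unfolding ins by simp
    qed
    moreover have "span (v ` {1..Suc i}) = flag_of l (Suc i)"
    proof (rule subset_antisym)
      show "span (v ` {1..Suc i}) \<subseteq> flag_of l (Suc i)"
      proof (rule span_minimal)
        have "v ` {1..i} \<subseteq> flag_of l i" unfolding sp[symmetric] by (rule span_superset)
        then show "v ` {1..Suc i} \<subseteq> flag_of l (Suc i)"
          unfolding ins using v(1) flag_of_mono[OF i] by auto
      qed (use subspace_flag_of i in simp)
      show "flag_of l (Suc i) \<subseteq> span (v ` {1..Suc i})"
      proof
        fix x assume "x \<in> flag_of l (Suc i)"
        then obtain y where y: "step_proj D l i y = y" "shift_steps D l i (coords x) = delta y"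
          using mem_flag_of_Suc[OF i] by blast
        obtain c where c: "y = c *s u i"
          using step_proj_range(2)[OF l u(2)[OF i] u(1)[OF i] y(1)] by auto
        have "shift_steps D l i (coords (v (Suc i))) = delta (u i)"
          unfolding v_def using shift_steps_step_vector[OF i u(1)[OF i]] by simp
        then have "shift_steps D l i (coords (x - scl c (v (Suc i)))) = (\<lambda>_. 0)"
          unfolding coords_diff coords_scale shift_steps_diff[OF l] shift_steps_linear[OF l]
          by (simp add: y(2) c delta_def fun_eq_iff)
        then have "x - scl c (v (Suc i)) \<in> span (v ` {1..i})"
          unfolding sp using i by (simp add: mem_flag_of)
        moreover have "span (v ` {1..i}) \<subseteq> span (v ` {1..Suc i})"
          unfolding ins by (intro span_mono) auto
        moreover have "scl c (v (Suc i)) \<in> span (v ` {1..Suc i})"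
          by (intro span_scale span_base) auto
        ultimately have "x - scl c (v (Suc i)) + scl c (v (Suc i)) \<in> span (v ` {1..Suc i})"
          by (intro span_add) auto
        then show "x \<in> span (v ` {1..Suc i})" by simp
      qed
    qed
    ultimately show ?case by blast
  qed
  then show "(\<lambda>j\<in>{1..i}. step_vector l (j - 1) (u (j - 1))) \<in> frames scl i"
    "span ((\<lambda>j\<in>{1..i}. step_vector l (j - 1) (u (j - 1))) ` {1..i}) = flag_of l i"
    unfolding frames_iff v_def[symmetric] vv im by auto
qed

text \<open>Applying \<open>shift_steps\<close> identifies \<open>V/F\<^sub>i\<close> with \<open>step_space l i\<close> and the induced map with the shift.\<close>

lemma image_power_iff:
  assumes i: "i < n"
  shows "quot_by (flag_of l i) U \<subseteq> induced_image_power N (flag_of l i) k \<longleftrightarrow>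
    (\<forall>v\<in>U. shift_steps D l i (coords v) \<in> (shift ^^ k) ` step_space l i)"
proof -
  let ?W = "flag_of l i"
  have W: "subspace ?W" using subspace_flag_of i by simp
  have NW: "N ` ?W \<subseteq> ?W"
    using N_flag_of[OF i] flag_of_mono[OF i] by auto
  have coset: "v +o ?W = v' +o ?W \<longleftrightarrow> v - v' \<in> ?W" for v v'
  proof
    assume "v +o ?W = v' +o ?W"
    moreover have "v \<in> v +o ?W"
      using subspace_0[OF W] by (auto simp: elt_set_plus_def intro: bexI[of _ 0])
    ultimately show "v - v' \<in> ?W" by (auto simp: elt_set_plus_def)
  next
    assume vW: "v - v' \<in> ?W"
    have "a +o ?W \<subseteq> b +o ?W" if "a - b \<in> ?W" for a b
    proof
      fix x assume "x \<in> a +o ?W"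
      then obtain w where "w \<in> ?W" "x = a + w" by (auto simp: elt_set_plus_def)
      then have "x = b + ((a - b) + w)" "(a - b) + w \<in> ?W"
        using subspace_add[OF W that] by auto
      then show "x \<in> b +o ?W" unfolding elt_set_plus_def by blast
    qed
    moreover have "v' - v \<in> ?W" using subspace_neg[OF W vW] by simp
    ultimately show "v +o ?W = v' +o ?W" using vW by blast
  qed
  have "v +o ?W \<in> induced_image_power N ?W k \<longleftrightarrow>
      shift_steps D l i (coords v) \<in> (shift ^^ k) ` step_space l i" for v
  proof -
    have "v +o ?W \<in> induced_image_power N ?W k \<longleftrightarrow> (\<exists>v'. v +o ?W = (N ^^ k) v' +o ?W)"
      unfolding induced_image_power_def quot_by_def image_image
        induced_map_coset(2)[OF N_linear W NW] by auto
    also have "\<dots> \<longleftrightarrow> (\<exists>v'. shift_steps D l i (coords v) = (shift ^^ k) (shift_steps D l i (coords v')))"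
      using i by (simp add: coset mem_flag_of coords_diff shift_steps_diff[OF l] coords_N_power
          shift_steps_shift_power fun_eq_iff)
    also have "\<dots> \<longleftrightarrow> shift_steps D l i (coords v) \<in> (shift ^^ k) ` range (\<lambda>v'. shift_steps D l i (coords v'))"
      by auto
    also have "range (\<lambda>v'. shift_steps D l i (coords v')) = step_space l i"
    proof (rule subset_antisym; rule subsetI)
      fix y assume "y \<in> range (\<lambda>v'. shift_steps D l i (coords v'))"
      then show "y \<in> step_space l i"
        using shift_steps_in_step_space_iff[OF l, of i] i coords_two_row_seqs by auto
    next
      fix y assume y: "y \<in> step_space l i"
      have "unshift_steps D l i y \<in> two_row_seqs (tops 0) (bots 0)"
        using shift_steps_in_step_space_iff[OF l, of i "unshift_steps D l i y"] i y shift_steps_unshift_steps[OF l] by simp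
      then have "y = shift_steps D l i (coords (vec_of (unshift_steps D l i y)))"
        by (simp add: coords_vec_of shift_steps_unshift_steps[OF l])
      then show "y \<in> range (\<lambda>v'. shift_steps D l i (coords v'))" by (rule range_eqI)
    qed
    finally show ?thesis .
  qed
  then show ?thesis by (auto simp: quot_by_def)
qed

lemma generic_flag_in_tableau_cell:
  assumes gen: "generic l"
  shows "flag_of l \<in> tableau_cell"
  unfolding tableau_cell_def
proof (intro CollectI conjI ballI flag_of_springer)
  fix i assume "i \<in> {1..n}"
  then obtain m where m: "i = Suc m" "m < n" by (cases i) auto
  have W: "subspace (flag_of l m)" using subspace_flag_of m by simp
  have NW: "N ` flag_of l m \<subseteq> flag_of l m"
    using N_flag_of[OF m(2)] flag_of_mono[OF m(2)] by auto
  have "quot_by (flag_of l m) (flag_of l (Suc m)) \<subseteq> induced_kernel N (flag_of l m)"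
  proof
    fix C assume "C \<in> quot_by (flag_of l m) (flag_of l (Suc m))"
    then obtain v where v: "v \<in> flag_of l (Suc m)" "C = v +o flag_of l m" by (auto simp: quot_by_def)
    have Nv: "N v \<in> flag_of l m" using N_flag_of[OF m(2) v(1)] .
    have "N v +o flag_of l m = flag_of l m"
    proof (rule subset_antisym; rule subsetI)
      fix x assume x: "x \<in> flag_of l m"
      then have "x = N v + (x - N v)" "x - N v \<in> flag_of l m"
        using subspace_diff[OF W x Nv] by auto
      then show "x \<in> N v +o flag_of l m" unfolding elt_set_plus_def by blast
    qed (use subspace_add[OF W Nv] in \<open>auto simp: elt_set_plus_def\<close>)
    then show "C \<in> induced_kernel N (flag_of l m)"
      using induced_map_coset(1)[OF N_linear W NW, of v]
      by (auto simp: induced_kernel_def quot_by_def v(2))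
  qed
  moreover have "quot_by (flag_of l m) (flag_of l (Suc m)) \<subseteq> induced_image_power N (flag_of l m) (column m - 1)"
    unfolding image_power_iff[OF m(2)]
    using mem_flag_of_Suc[OF m(2)] generic_column(1)[OF l gen m(2)] by auto
  ultimately show "quot_by (flag_of l (i - 1)) (flag_of l i) \<subseteq>
      induced_kernel N (flag_of l (i - 1)) \<inter>
      induced_image_power N (flag_of l (i - 1)) (column (i - 1) - 1)"
    by (simp add: m(1))
  obtain a where a: "step_proj D l m a \<noteq> 0" using step_proj_range(1)[OF l, where i = m] by auto
  let ?u = "step_proj D l m a"
  have u: "step_proj D l m ?u = ?u" using is_projD(3)[OF is_proj_step[OF l]] .
  have "shift_steps D l m (coords (step_vector l m ?u)) \<notin> (shift ^^ column m) ` step_space l m"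
    unfolding shift_steps_step_vector[OF m(2) u] using generic_column(2)[OF l gen m(2) u a] .
  then show "\<not> quot_by (flag_of l (i - 1)) (flag_of l i) \<subseteq>
      induced_image_power N (flag_of l (i - 1)) (column (i - 1))"
    using image_power_iff[OF m(2)] step_vector_in_flag_of(1)[OF m(2) u a] by (auto simp: m(1))
qed

end

lemma flag_of_cong:
  assumes "\<And>j. j \<in> D \<Longrightarrow> j \<le> i \<Longrightarrow> l j = l' j"
  shows "flag_of l i = flag_of l' i"
  using shift_steps_cong[of D i l l'] assms by (simp add: flag_of_def restrict_def)

lemma dim_complete_flag:
  assumes F: "F \<in> complete_flags scl n" and "i \<le> n"
  shows "dim (F i) = i"
proof -
  have sub: "subspace (F i)" if "i \<le> n" for i
    using F that by (auto simp: complete_flags_def)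
  have less: "dim (F i) < dim (F (Suc i))" if "i < n" for i
  proof (rule dim_psubset)
    have "F i \<subset> F (Suc i)" using F that by (auto simp: complete_flags_def)
    then show "span (F i) \<subset> span (F (Suc i))"
      using sub[of i] sub[of "Suc i"] that by (metis Suc_leI less_imp_le span_eq_iff)
  qed
  have lower: "i \<le> dim (F i)" if "i \<le> n" for i
    using that
  proof (induction i)
    case (Suc i)
    then show ?case using less[of i] by simp
  qed simp
  have "dim (F i) + (n - i) \<le> n"
    using assms(2)
  proof (induction rule: inc_induct)
    case base
    then show ?case using F dim_UNIV by (simp add: complete_flags_def)
  next
    case (step m)
    then show ?case using less[of m] by simp
  qed
  then show ?thesis using lower[OF assms(2)] assms(2) by simp
qed

text \<open>By dimension, both spaces coincide with their intersection.\<close>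

lemma flag_step_unique:
  assumes F: "F \<in> complete_flags scl n" and G: "G \<in> complete_flags scl n" and i: "i < n"
    and eq: "F i = G i" and v: "v \<in> F (Suc i)" "v \<in> G (Suc i)" "v \<notin> F i"
  shows "F (Suc i) = G (Suc i)"
proof -
  have sF: "subspace (F (Suc i))" "subspace (F i)" and sG: "subspace (G (Suc i))"
    using F G i by (auto simp: complete_flags_def)
  let ?S = "F (Suc i) \<inter> G (Suc i)"
  have sS: "subspace ?S" using sF(1) sG by (rule subspace_inter)
  have "F i \<subset> F (Suc i)" "G i \<subset> G (Suc i)"
    using F G i by (auto simp: complete_flags_def)
  then have "F i \<subset> ?S"
    using eq v by blast
  then have "dim (F i) < dim ?S"
    using sS sF(2) by (intro dim_psubset) (metis span_eq_iff)
  then have dim: "dim ?S \<ge> Suc i" using dim_complete_flag[OF F, of i] i by simp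
  have "?S = F (Suc i)"
    using dim dim_complete_flag[OF F, of "Suc i"] i by (intro subspace_dim_equal sS sF) auto
  moreover have "?S = G (Suc i)"
    using dim dim_complete_flag[OF G, of "Suc i"] i by (intro subspace_dim_equal sS sG) auto
  ultimately show ?thesis by simp
qed

text \<open>The lines are found one after the other. If \<open>F\<close> agrees with a flag of the model up to step \<open>m\<close>, then \<open>F\<^sub>m\<^sub>+\<^sub>1/F\<^sub>m\<close> is
spanned by a vector in the kernel of the induced map, which corresponds to some \<open>u \<in> \<complex>\<^sup>2\<close>. At a
number in the bottom row the line of \<open>u\<close> becomes the chosen line; at a number in the top row the
projection is already determined, and \<open>top_forced\<close> says that \<open>u\<close> lies in its image.\<close>

lemma tableau_cell_subset_flags:
  assumes F: "F \<in> tableau_cell"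
  shows "\<exists>l\<in>D \<rightarrow>\<^sub>E lines. F = flag_of l"
proof -
  have Fs: "F \<in> springer_fiber scl n N" using F by (simp add: tableau_cell_def)
  then have Fc: "F \<in> complete_flags scl n" by (simp add: springer_fiber_def)
  have "\<exists>l\<in>D \<rightarrow>\<^sub>E lines. \<forall>i\<le>m. F i = flag_of l i" if "m \<le> n" for m
    using that
  proof (induction m)
    case 0
    have "flag_of l 0 = {0}" for l by (auto simp: flag_of_def coords_eq_0_iff)
    moreover have "(\<lambda>j\<in>D. first_line) \<in> D \<rightarrow>\<^sub>E lines" by (simp add: first_line)
    ultimately show ?case using Fc by (intro bexI[of _ "\<lambda>j\<in>D. first_line"]) (auto simp: complete_flags_def)
  next
    case (Suc m)
    then obtain l where l: "l \<in> D \<rightarrow>\<^sub>E lines" and eq: "\<And>i. i \<le> m \<Longrightarrow> F i = flag_of l i" and m: "m < n"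
      by auto
    have ll: "l \<in> D \<rightarrow> lines" using l by auto
    have "F m \<subset> F (Suc m)" using Fc m by (auto simp: complete_flags_def)
    then obtain v where v: "v \<in> F (Suc m)" "v \<notin> F m" by blast
    have "N v \<in> flag_of l m"
      using Fs m v eq[of m] unfolding springer_fiber_def by fastforce
    then have "shift (shift_steps D l m (coords v)) = (\<lambda>_. 0)"
      using m shift_steps_shift_power[of D l m 1] by (simp add: mem_flag_of[OF ll] coords_N)
    then obtain u where u: "shift_steps D l m (coords v) = delta u"
      using shift_eq_0_imp_delta by blast
    have u0: "u \<noteq> 0"
      using v(2) eq[of m] u m by (auto simp: mem_flag_of[OF ll] delta_def)
    have "\<exists>l'\<in>D \<rightarrow>\<^sub>E lines. (\<forall>j. j \<in> D \<longrightarrow> j \<le> m \<longrightarrow> l' j = l j) \<and> step_proj D l' m u = u"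
    proof (cases "Suc m \<in> D")
      case True
      have lu: "line_of u \<in> lines" using u0 by (simp add: lines_def)
      have "u \<in> line_of u" by (rule mem_line_of)
      then have "proj (line_of u) u = u" using line_of_iff_proj[OF lu] by simp
      then show ?thesis
        using True l lu by (intro bexI[of _ "l(Suc m := line_of u)"])
          (auto simp: step_proj_def PiE_iff extensional_def)
    next
      case False
      have "quot_by (F m) (F (Suc m)) \<subseteq> induced_image_power N (F m) (column m - 1)"
        using F m unfolding tableau_cell_def by (auto dest!: bspec[of _ _ "Suc m"])
      then have "\<forall>v\<in>F (Suc m). shift_steps D l m (coords v) \<in> (shift ^^ (column m - 1)) ` step_space l m"
        unfolding eq[OF order_refl] by (rule image_power_iff[OF ll m, THEN iffD1])
      from bspec[OF this v(1)] have "delta u \<in> (shift ^^ (tops m - 1)) ` step_space l m"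
        unfolding u column_def using False by simp
      then have "step_proj D l m u = u" by (rule top_forced[OF ll m False])
      then show ?thesis using l by blast
    qed
    then obtain l' where l': "l' \<in> D \<rightarrow>\<^sub>E lines" "\<And>j. j \<in> D \<Longrightarrow> j \<le> m \<Longrightarrow> l' j = l j"
        "step_proj D l' m u = u" by blast
    have ll': "l' \<in> D \<rightarrow> lines" using l'(1) by auto
    have eq': "F i = flag_of l' i" if "i \<le> m" for i
      using eq[OF that] flag_of_cong[of i l' l] l'(2) that by simp
    have "shift_steps D l' m (coords v) = delta u"
      using u shift_steps_cong[of D m l' l] l'(2) by simp
    then have v': "v \<in> flag_of l' (Suc m)"
      using mem_flag_of_Suc[OF ll' m] l'(3) by blast
    have "flag_of l' \<in> complete_flags scl n"
      using flag_of_springer[OF ll'] by (simp add: springer_fiber_def)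
    from flag_step_unique[OF Fc this m eq'[OF order_refl] v(1) v' v(2)]
    have "F (Suc m) = flag_of l' (Suc m)" .
    then have "\<forall>i\<le>Suc m. F i = flag_of l' i" using eq' by (auto simp: le_Suc_eq)
    then show ?case using l'(1) by (intro bexI[of _ l'])
  qed
  from this[OF order_refl] obtain l
    where l: "l \<in> D \<rightarrow>\<^sub>E lines" "\<And>i. i \<le> n \<Longrightarrow> F i = flag_of l i" by auto
  have "F = flag_of l"
  proof
    fix i show "F i = flag_of l i"
      using l(2)[of i] Fc by (cases "i \<le> n") (auto simp: flag_of_def complete_flags_def PiE_iff extensional_def)
  qed
  then show ?thesis using l(1) by blast
qed

text \<open>Once the earlier lines are known, the space \<open>F\<^sub>i\<^sub>+\<^sub>1\<close> determines the kernel of the next partial shift, and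
this kernel is the line chosen at \<open>i + 1\<close>.\<close>

lemma inj_on_flag_of: "inj_on flag_of (D \<rightarrow>\<^sub>E lines)"
proof (rule inj_onI)
  fix l l' assume l: "l \<in> D \<rightarrow>\<^sub>E lines" and l': "l' \<in> D \<rightarrow>\<^sub>E lines" and eq: "flag_of l = flag_of l'"
  have ll: "l \<in> D \<rightarrow> lines" "l' \<in> D \<rightarrow> lines" using l l' by auto
  have "j \<in> D \<Longrightarrow> l j = l' j" for j
  proof (induction j rule: less_induct)
    case (less j)
    then obtain i where i: "j = Suc i" "i < n" using D_sub by (cases j) auto
    have same: "shift_steps D l i w = shift_steps D l' i w" for w
      using less.IH i by (intro shift_steps_cong) auto
    obtain u where u: "u \<in> l j" "u \<noteq> 0" using line_nonzero[OF Pi_mem[OF ll(1) less.prems]] .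
    have up: "step_proj D l i u = u"
      using u(1) less.prems i Pi_mem[OF ll(1)] by (simp add: step_proj_def line_of_iff_proj)
    have "step_vector l i u \<in> flag_of l' (Suc i)"
      using step_vector_in_flag_of(1)[OF ll(1) i(2) up u(2)] eq by simp
    then have "\<exists>u'. step_proj D l' i u' = u' \<and> shift_steps D l' i (coords (step_vector l i u)) = delta u'"
      by (rule mem_flag_of_Suc[OF ll(2) i(2), THEN iffD1])
    then obtain u' where u': "step_proj D l' i u' = u'" "shift_steps D l' i (coords (step_vector l i u)) = delta u'"
      by auto
    moreover have "shift_steps D l' i (coords (step_vector l i u)) = delta u"
      unfolding same[symmetric] using ll(1) i(2) up by (rule shift_steps_step_vector)
    ultimately have "delta u = delta u'" by simp
    then have "u = u'" by (metis delta_def)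
    then have "u \<in> l' j"
      using u'(1) less.prems i Pi_mem[OF ll(2)] by (simp add: step_proj_def line_of_iff_proj)
    then show ?case
      using line_eqI[OF Pi_mem[OF ll(1) less.prems] Pi_mem[OF ll(2) less.prems] u(1) _ u(2)] by blast
  qed
  then show "l = l'" using l l' by (intro PiE_ext) auto
qed

text \<open>Continuity is local. Near a given choice of lines, fixed vectors of \<open>\<complex>\<^sup>2\<close> have nonzero projections to
all lines, and these projections give an adapted frame that varies continuously.\<close>

lemma continuous_flag_of: "continuous_map line_space (flag_variety scl n) flag_of"
proof -
  have lines: "l \<in> D \<rightarrow> lines" if "l \<in> topspace line_space" for l
    using that by (auto simp: topspace_projective_line)
  have comp: "continuous_map line_space (grassmannian scl i) (\<lambda>l. flag_of l i)" if i: "i \<le> n" for i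
  proof -
    have cont_line: "continuous_map line_space projective_line (\<lambda>l. l j)" if "j \<in> D" for j
      using that by (rule continuous_map_product_projection)
    have "\<forall>l\<in>topspace line_space. \<exists>a. \<forall>j. step_proj D l j (a j) \<noteq> 0"
    proof
      fix l assume "l \<in> topspace line_space"
      then have "\<forall>j. \<exists>a. step_proj D l j a \<noteq> 0"
        using step_proj_range(1)[OF lines] by blast
      then show "\<exists>a. \<forall>j. step_proj D l j (a j) \<noteq> 0" by (rule choice)
    qed
    then obtain a where a: "\<And>l j. l \<in> topspace line_space \<Longrightarrow> step_proj D l j (a l j) \<noteq> 0"
      by metis
    define T where "T l0 = (\<Inter>j\<in>{..<n}. {l \<in> topspace line_space. step_proj D l j (a l0 j) \<in> - {0}}) \<inter> topspace line_space" for l0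
    define fr where "fr l0 l = (\<lambda>j\<in>{1..i}. step_vector l (j - 1) (step_proj D l (j - 1) (a l0 (j - 1))))" for l0 l
    have "openin line_space {l \<in> topspace line_space. step_proj D l j (a l0 j) \<in> - {0}}" for j l0
      by (rule openin_continuous_map_preimage[of _ euclidean])
         (auto intro!: continuous_step_proj cont_line)
    then have open_T: "openin line_space (T l0)" for l0
      unfolding T_def by (intro openin_INT finite_lessThan)
    show ?thesis
    proof (rule pasting_lemma[where I = "topspace line_space" and T = T and f = "\<lambda>_ l. flag_of l i"])
      fix l0 assume l0: "l0 \<in> topspace line_space"
      let ?Z = "subtopology line_space (T l0)"
      have inT: "l \<in> topspace line_space" "\<And>j. j < n \<Longrightarrow> step_proj D l j (a l0 j) \<noteq> 0" if "l \<in> T l0" for l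
        using that by (auto simp: T_def)
      have Zline: "continuous_map ?Z projective_line (\<lambda>l. l j)" if "j \<in> D" for j
        using cont_line[OF that] by (rule continuous_map_from_subtopology)
      have fr: "fr l0 l \<in> frames scl i" "span (fr l0 l ` {1..i}) = flag_of l i" if "l \<in> T l0" for l
        unfolding fr_def
        using flag_frame[of l "\<lambda>j. step_proj D l j (a l0 j)" i] lines[OF inT(1)[OF that]] inT(2)[OF that]
          is_projD(3)[OF is_proj_step[of l D]] i by auto
      have "continuous_map ?Z (frame_space i) (fr l0)"
        unfolding frame_space_def continuous_map_in_subtopology continuous_map_componentwise
      proof (intro conjI ballI)
        fix j assume "j \<in> {1..i}"
        have "continuous_map ?Z euclidean (\<lambda>l. unshift_steps D l (j - 1) (delta (step_proj D l (j - 1) (a l0 (j - 1)))) k)" for k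
        proof (rule continuous_unshift_steps[OF Zline])
          show "continuous_map ?Z euclidean (\<lambda>l. delta (step_proj D l (j - 1) (a l0 (j - 1))) k)" for k
            unfolding delta_def
            by (cases "k = 0") (auto intro!: continuous_step_proj Zline)
        qed
        then have "continuous_map ?Z (vs_topology scl) (\<lambda>l. step_vector l (j - 1) (step_proj D l (j - 1) (a l0 (j - 1))))"
          unfolding step_vector_def by (rule vec_of_continuous)
        then show "continuous_map ?Z (vs_topology scl) (\<lambda>l. fr l0 l j)"
          using \<open>j \<in> {1..i}\<close> by (simp add: fr_def)
      next
        show "fr l0 \<in> topspace ?Z \<rightarrow> frames scl i"
          using fr(1) by auto
      qed (auto simp: fr_def)
      then have "continuous_map ?Z (grassmannian scl i) ((\<lambda>v. span (v ` {1..i})) \<circ> fr l0)"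
        by (rule continuous_map_compose[OF _ quotient_imp_continuous_map[OF quotient_map_grassmannian]])
      then show "continuous_map ?Z (grassmannian scl i) (\<lambda>l. flag_of l i)"
        by (rule continuous_map_eq) (use fr(2) in auto)
    next
      fix l assume l: "l \<in> topspace line_space"
      then have "l \<in> T l" using a by (auto simp: T_def)
      then show "\<exists>j. j \<in> topspace line_space \<and> l \<in> T j \<and> flag_of l i = flag_of l i"
        using l by blast
    qed (use open_T in auto)
  qed
  show ?thesis
    unfolding flag_variety_def continuous_map_in_subtopology continuous_map_componentwise
  proof (intro conjI ballI)
    show "flag_of ` topspace line_space \<subseteq> extensional {0..n}"
      by (auto simp: flag_of_def)
    show "flag_of \<in> topspace line_space \<rightarrow> complete_flags scl n"
      using flag_of_springer lines by (auto simp: springer_fiber_def)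
  qed (use comp in auto)
qed

text \<open>Given a box around a family of lines, replace its lines one after the other: genericity excludes a
single line for each opening parenthesis, and this line depends only on the earlier choices.\<close>

lemma generic_dense:
  assumes U: "openin line_space U" and "l0 \<in> U"
  shows "\<exists>l\<in>U. generic l"
proof -
  obtain X where X: "l0 \<in> Pi\<^sub>E D X" "\<And>j. openin projective_line (X j)" "Pi\<^sub>E D X \<subseteq> U"
    using product_topology_open_contains_basis[OF U \<open>l0 \<in> U\<close>] by metis
  have Xl: "X j \<subseteq> lines" for j
    using openin_subset[OF X(2)[of j]] by (simp add: topspace_projective_line)
  have "\<exists>l\<in>Pi\<^sub>E D X. \<forall>j\<in>D. j \<le> m \<longrightarrow> perp_vec l (open_stack D (j - 1)) \<notin> l j" for m
  proof (induction m)
    case 0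
    then show ?case using X(1) D_sub by (intro bexI[of _ l0]) auto
  next
    case (Suc m)
    then obtain l where l: "l \<in> Pi\<^sub>E D X" "\<And>j. j \<in> D \<Longrightarrow> j \<le> m \<Longrightarrow> perp_vec l (open_stack D (j - 1)) \<notin> l j"
      by blast
    have ll: "l \<in> D \<rightarrow> lines" using l(1) Xl by (auto simp: PiE_iff)
    show ?case
    proof (cases "Suc m \<in> D")
      case False
      then show ?thesis using l by (intro bexI[of _ l]) (auto simp: le_Suc_eq)
    next
      case True
      let ?x = "perp_vec l (open_stack D m)"
      have x0: "?x \<noteq> 0"
        using generic_stack_open_stack[OF ll, of m] l(2) by (intro perp_vec_nonzero) auto
      have xl: "line_of ?x \<in> lines" using x0 by (simp add: lines_def)
      have xx: "?x \<in> line_of ?x" by (rule mem_line_of)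
      have "l (Suc m) \<in> X (Suc m)" using l(1) True by auto
      then obtain k where k: "k \<in> X (Suc m)" "k \<noteq> line_of ?x"
        using no_isolated_line[OF X(2)[of "Suc m"]] by blast
      then have xk: "?x \<notin> k" using line_eqI[of k "line_of ?x"] xl xx x0 Xl by blast
      define l' where "l' = l(Suc m := k)"
      have perp: "perp_vec l' (open_stack D (j - 1)) = perp_vec l (open_stack D (j - 1))" if "j \<le> Suc m" for j
      proof (rule perp_vec_cong)
        fix k' assume "k' \<in> set (open_stack D (j - 1))"
        then have "k' \<in> D \<inter> {1..j - 1}" using set_open_stack by blast
        then have "k' \<le> m" using that by simp linarith
        then show "l' k' = l k'" by (simp add: l'_def)
      qed
      have "l' \<in> Pi\<^sub>E D X" using l(1) k(1) True by (auto simp: l'_def PiE_iff extensional_def)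
      moreover have "perp_vec l' (open_stack D (j - 1)) \<notin> l' j" if "j \<in> D" "j \<le> Suc m" for j
        using perp[OF that(2)] l(2)[OF that(1)] xk that by (cases "j = Suc m") (auto simp: l'_def)
      ultimately show ?thesis by blast
    qed
  qed
  then obtain l where "l \<in> Pi\<^sub>E D X" "\<forall>j\<in>D. j \<le> n \<longrightarrow> perp_vec l (open_stack D (j - 1)) \<notin> l j" by blast
  then show ?thesis using X(3) D_sub by (auto simp: generic_def intro!: bexI[of _ l])
qed

text \<open>The image of \<open>flag_of\<close> is compact, hence closed, and contains \<open>SV(A)\<close>. The flags of generic families
lie in \<open>SV(A)\<close> and are dense in the image.\<close>

lemma closure_tableau_cell:
  "subtopology (flag_variety scl n) (springer_fiber scl n N) closure_of tableau_cell = flag_of ` (D \<rightarrow>\<^sub>E lines)"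
proof (rule subset_antisym)
  let ?Y = "subtopology (flag_variety scl n) (springer_fiber scl n N)"
  have top: "topspace line_space = D \<rightarrow>\<^sub>E lines" by (simp add: topspace_projective_line)
  have cont: "continuous_map line_space ?Y flag_of"
    using continuous_flag_of flag_of_springer unfolding continuous_map_in_subtopology top
    by (auto simp: PiE_iff)
  have "compact_space line_space"
    by (simp add: compact_space_product_topology compact_projective_line)
  then have "compactin ?Y (flag_of ` topspace line_space)"
    using cont unfolding compact_space_def by (rule image_compactin)
  moreover have "Hausdorff_space ?Y" by (intro Hausdorff_space_subtopology Hausdorff_flag_variety)
  ultimately have "closedin ?Y (flag_of ` (D \<rightarrow>\<^sub>E lines))"
    unfolding top by (rule compactin_imp_closedin[rotated])
  then show "?Y closure_of tableau_cell \<subseteq> flag_of ` (D \<rightarrow>\<^sub>E lines)"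
    using tableau_cell_subset_flags by (intro closure_of_minimal) auto
  show "flag_of ` (D \<rightarrow>\<^sub>E lines) \<subseteq> ?Y closure_of tableau_cell"
  proof clarify
    fix l assume l: "l \<in> D \<rightarrow>\<^sub>E lines"
    show "flag_of l \<in> ?Y closure_of tableau_cell"
      unfolding in_closure_of
    proof (intro conjI allI impI)
      show "flag_of l \<in> topspace ?Y"
        using continuous_map_image_subset_topspace[OF cont] l unfolding top by blast
      fix U assume "flag_of l \<in> U \<and> openin ?Y U"
      then have "openin line_space {l \<in> topspace line_space. flag_of l \<in> U}" "flag_of l \<in> U"
        using openin_continuous_map_preimage[OF cont] by auto
      then obtain l' where "l' \<in> D \<rightarrow>\<^sub>E lines" "flag_of l' \<in> U" "generic l'"
        using generic_dense[of "{l \<in> topspace line_space. flag_of l \<in> U}" l] l unfolding top by auto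
      then show "\<exists>y. y \<in> tableau_cell \<and> y \<in> U"
        using generic_flag_in_tableau_cell[of l'] by (intro exI[of _ "flag_of l'"]) auto
    qed
  qed
qed

text \<open>A continuous bijection from a compact space to a Hausdorff space.\<close>

lemma homeomorphic_map_flag_of:
  "homeomorphic_map line_space (subtopology (flag_variety scl n) (flag_of ` (D \<rightarrow>\<^sub>E lines))) flag_of"
proof (rule bijective_closed_imp_homeomorphic_map)
  let ?K = "subtopology (flag_variety scl n) (flag_of ` (D \<rightarrow>\<^sub>E lines))"
  have top: "topspace line_space = D \<rightarrow>\<^sub>E lines" by (simp add: topspace_projective_line)
  show cont: "continuous_map line_space ?K flag_of"
    using continuous_flag_of unfolding continuous_map_in_subtopology top by auto
  have "compact_space line_space"
    by (simp add: compact_space_product_topology compact_projective_line)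
  moreover have "kc_space ?K"
    by (intro Hausdorff_imp_kc_space Hausdorff_space_subtopology Hausdorff_flag_variety)
  ultimately show "closed_map line_space ?K flag_of"
    using cont by (rule continuous_imp_closed_map_gen)
  show "inj_on flag_of (topspace line_space)" unfolding top by (rule inj_on_flag_of)
  show "flag_of ` topspace line_space = topspace ?K"
    using continuous_map_image_subset_topspace[OF continuous_flag_of] unfolding top by auto
qed

end

section \<open>Products as iterated fiber bundles\<close>

lemma continuous_map_fun_upd:
  assumes "continuous_map Z (product_topology T I) f" "continuous_map Z (T d) g" "d \<in> J" "J \<subseteq> insert d I"
    and "\<And>z. z \<in> topspace Z \<Longrightarrow> (f z)(d := g z) \<in> extensional J"
  shows "continuous_map Z (product_topology T J) (\<lambda>z. (f z)(d := g z))"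
  unfolding continuous_map_componentwise
proof (intro conjI ballI)
  fix j assume j: "j \<in> J"
  show "continuous_map Z (T j) (\<lambda>z. ((f z)(d := g z)) j)"
  proof (cases "j = d")
    case True
    then show ?thesis using assms(2) by simp
  next
    case False
    then have "j \<in> I" using j assms(4) by auto
    then show ?thesis using assms(1) False by (simp add: continuous_map_componentwise)
  qed
qed (use assms(5) in auto)

text \<open>Split off one factor at a time. The typical fiber has to have points of the same type as the total
space; it is the subspace of \<open>X\<close> on which the coordinate that was split off has a fixed value.\<close>

lemma iterated_fiber_bundle_of_product:
  assumes "finite D" "homeomorphic_map (product_topology (\<lambda>_. P) D) X \<Phi>" "topspace P \<noteq> {}"
  shows "iterated_fiber_bundle X (replicate (card D) P)"
  using assms(1,2)
proof (induction D arbitrary: X \<Phi>)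
  case empty
  have "\<Phi> ` {\<lambda>_. undefined} = topspace X"
    using homeomorphic_imp_surjective_map[OF empty] by simp
  then have "topspace X = {\<Phi> (\<lambda>_. undefined)}" by simp
  then show ?case
    unfolding iterated_fiber_bundle_def by (intro exI[of _ "\<lambda>_. X"]) auto
next
  case (insert d D)
  let ?E = "product_topology (\<lambda>_. P) (insert d D)" and ?E' = "product_topology (\<lambda>_. P) D"
  obtain \<Psi> where maps: "homeomorphic_maps ?E X \<Phi> \<Psi>"
    using insert.prems homeomorphic_map_maps by blast
  have \<Phi>: "continuous_map ?E X \<Phi>" and \<Psi>: "continuous_map X ?E \<Psi>"
    and \<Psi>\<Phi>: "\<And>f. f \<in> topspace ?E \<Longrightarrow> \<Psi> (\<Phi> f) = f" and \<Phi>\<Psi>: "\<And>x. x \<in> topspace X \<Longrightarrow> \<Phi> (\<Psi> x) = x"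
    using maps by (auto simp: homeomorphic_maps_def)
  have \<Psi>_in: "\<Psi> x \<in> topspace ?E" if "x \<in> topspace X" for x
    using continuous_map_image_subset_topspace[OF \<Psi>] that by blast
  have \<Phi>_in: "\<Phi> f \<in> topspace X" if "f \<in> topspace ?E" for f
    using continuous_map_image_subset_topspace[OF \<Phi>] that by blast
  obtain y0 where y0: "y0 \<in> topspace P" using assms(3) by blast
  define S where "S = {x \<in> topspace X. \<Psi> x d = y0}"
  define X' where "X' = subtopology X S"
  have top': "topspace X' = S" by (auto simp: X'_def S_def)
  have upd: "f(d := y) \<in> topspace ?E" if "f \<in> topspace ?E \<or> f \<in> topspace ?E'" "y \<in> topspace P" for f y
    using that by (auto simp: PiE_iff extensional_def)
  have upd0: "\<Phi> (f(d := y0)) \<in> S" if "f \<in> topspace ?E \<or> f \<in> topspace ?E'" for f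
    using upd[OF that y0] \<Phi>_in \<Psi>\<Phi> by (simp add: S_def)
  have S_upd: "(\<Psi> x)(d := y0) = \<Psi> x" if "x \<in> S" for x
    using that by (auto simp: S_def)
  have contX': "continuous_map X' ?E \<Psi>"
    unfolding X'_def using \<Psi> by (rule continuous_map_from_subtopology)
  have proj_d: "continuous_map Z P (\<lambda>z. f z d)" if "continuous_map Z ?E f" for f and Z :: "'z topology"
    using that by (simp add: continuous_map_componentwise)
  have const: "continuous_map Z P (\<lambda>_. y0)" for Z :: "'z topology" using y0 by simp

  have "homeomorphic_maps ?E' X' (\<lambda>f. \<Phi> (f(d := y0))) (\<lambda>x. restrict (\<Psi> x) D)"
    unfolding homeomorphic_maps_def
  proof (intro conjI ballI)
    have "continuous_map ?E' ?E (\<lambda>f. f(d := y0))"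
      using y0 by (intro continuous_map_fun_upd[where I = D]) (auto simp: extensional_def PiE_iff)
    from continuous_map_compose[OF this \<Phi>]
    show "continuous_map ?E' X' (\<lambda>f. \<Phi> (f(d := y0)))"
      unfolding X'_def continuous_map_in_subtopology using upd0 by (auto simp: o_def)
    show "continuous_map X' ?E' (\<lambda>x. restrict (\<Psi> x) D)"
      using contX' by (auto simp: continuous_map_componentwise)
  next
    fix f assume f: "f \<in> topspace ?E'"
    show "restrict (\<Psi> (\<Phi> (f(d := y0)))) D = f"
      using f insert.hyps(2) upd[OF disjI2[OF f] y0] \<Psi>\<Phi> by (auto simp: PiE_iff extensional_def fun_eq_iff)
  next
    fix x assume "x \<in> topspace X'"
    then have x: "x \<in> S" by (simp add: top')
    then have xX: "x \<in> topspace X" by (simp add: S_def)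
    have "(restrict (\<Psi> x) D)(d := y0) = \<Psi> x"
      using x \<Psi>_in[OF xX] by (auto simp: S_def PiE_iff extensional_def fun_eq_iff)
    then show "\<Phi> ((restrict (\<Psi> x) D)(d := y0)) = x" using \<Phi>\<Psi>[OF xX] by simp
  qed
  then have "homeomorphic_map ?E' X' (\<lambda>f. \<Phi> (f(d := y0)))"
    using homeomorphic_map_maps by blast
  from insert.IH[OF this] obtain Xs p where
    Xs: "Xs 0 = X'" "\<And>j. j < card D \<Longrightarrow> fiber_bundle (Xs j) P (p j) (Xs (Suc j))"
      "\<exists>x. topspace (Xs (card D)) = {x}"
    unfolding iterated_fiber_bundle_def by auto

  define h where "h x = (\<Psi> x d, \<Phi> ((\<Psi> x)(d := y0)))" for x
  define k where "k = (\<lambda>(y, x). \<Phi> ((\<Psi> x)(d := y)))"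
  have "homeomorphic_maps X (prod_topology P X') h k"
    unfolding homeomorphic_maps_def
  proof (intro conjI ballI)
    have "continuous_map X ?E (\<lambda>x. (\<Psi> x)(d := y0))"
      using y0 \<Psi>_in by (intro continuous_map_fun_upd[OF \<Psi> ]) (auto simp: extensional_def PiE_iff)
    from continuous_map_compose[OF this \<Phi>]
    have "continuous_map X X' (\<lambda>x. \<Phi> ((\<Psi> x)(d := y0)))"
      unfolding X'_def continuous_map_in_subtopology using upd0 \<Psi>_in by (auto simp: o_def)
    then show "continuous_map X (prod_topology P X') h"
      unfolding h_def by (intro continuous_map_pairedI proj_d \<Psi>)
    have "continuous_map (prod_topology P X') ?E (\<Psi> \<circ> snd)"
      by (rule continuous_map_compose[OF continuous_map_snd contX'])
    then have "continuous_map (prod_topology P X') ?E (\<lambda>z. ((\<Psi> \<circ> snd) z)(d := fst z))"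
      by (rule continuous_map_fun_upd[OF _ continuous_map_fst])
         (use \<Psi>_in top' in \<open>auto simp: S_def extensional_def PiE_iff\<close>)
    from continuous_map_compose[OF this \<Phi>]
    show "continuous_map (prod_topology P X') X k"
      by (simp add: k_def o_def case_prod_beta')
  next
    fix x assume x: "x \<in> topspace X"
    have "(\<Psi> x)(d := y0) \<in> topspace ?E" using upd[OF disjI1[OF \<Psi>_in[OF x]] y0] .
    then show "k (h x) = x" using \<Psi>\<Phi> \<Phi>\<Psi>[OF x] by (simp add: h_def k_def)
  next
    fix z assume "z \<in> topspace (prod_topology P X')"
    then obtain y x where z: "z = (y, x)" "y \<in> topspace P" "x \<in> S"
      by (cases z) (auto simp: top')
    then have xX: "x \<in> topspace X" by (simp add: S_def)
    have "(\<Psi> x)(d := y) \<in> topspace ?E" using upd[OF disjI1[OF \<Psi>_in[OF xX]] z(2)] .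
    then show "h (k z) = z" using \<Psi>\<Phi> \<Phi>\<Psi>[OF xX] S_upd[OF z(3)] by (simp add: h_def k_def z(1))
  qed
  then have h: "homeomorphic_map X (prod_topology P X') h"
    using homeomorphic_map_maps by blast
  have inP: "\<Psi> x d \<in> topspace P" if "x \<in> topspace X" for x
    using \<Psi>_in[OF that] by auto
  then have "{x \<in> topspace X. \<Psi> x d \<in> topspace P} = topspace X" by auto
  then have first_bundle: "fiber_bundle X P (\<lambda>x. \<Psi> x d) X'"
    unfolding fiber_bundle_def
    by (intro conjI ballI proj_d \<Psi> exI[of _ "topspace P"] exI[of _ h]) (use h in \<open>auto simp: h_def\<close>)
  show ?case
    unfolding iterated_fiber_bundle_def
  proof (rule exI[of _ "case_nat X Xs"], rule exI[of _ "case_nat (\<lambda>x. \<Psi> x d) p"], intro conjI allI impI)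
    show "case_nat X Xs 0 = X" by simp
    have card: "length (replicate (card (insert d D)) P) = Suc (card D)"
      using insert.hyps by simp
    show "\<exists>x. topspace (case_nat X Xs (length (replicate (card (insert d D)) P))) = {x}"
      unfolding card using Xs(3) by simp
    fix j assume j: "j < length (replicate (card (insert d D)) P)"
    then have "replicate (card (insert d D)) P ! j = P" by simp
    then show "fiber_bundle (case_nat X Xs j) (replicate (card (insert d D)) P ! j)
        (case_nat (\<lambda>x. \<Psi> x d) p j) (case_nat X Xs (Suc j))"
      using j first_bundle Xs(1,2) unfolding card by (cases j) simp_all
  qed
qed

section \<open>Standard tableaux with two rows\<close>

text \<open>Absent rows have length \<open>0\<close>, which allows shapes with fewer than two rows to be treated like the others.\<close>

definition row_length :: "nat list \<Rightarrow> nat \<Rightarrow> nat" where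
  "row_length ls r = (if r \<in> {1..length ls} then ls ! (r - 1) else 0)"

lemma mem_young_cells: "(r, k) \<in> young_cells ls \<longleftrightarrow> k \<in> {1..row_length ls r}"
  by (auto simp: young_cells_def row_length_def)

lemma young_cells_two_rows:
  assumes "length ls \<le> 2"
  shows "young_cells ls = Pair 1 ` {1..row_length ls 1} \<union> Pair 2 ` {1..row_length ls 2}"
proof -
  have "r = 1 \<or> r = 2" if "(r, k) \<in> young_cells ls" for r k
    using that assms by (auto simp: young_cells_def)
  then have "(r, k) \<in> young_cells ls \<longleftrightarrow>
      (r, k) \<in> Pair 1 ` {1..row_length ls 1} \<union> Pair 2 ` {1..row_length ls 2}" for r k
    by (metis (no_types, lifting) Un_iff image_iff mem_young_cells prod.inject)
  then show ?thesis by (intro set_eqI) (metis surj_pair)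
qed

lemma row_length_mono:
  assumes "sorted_wrt (\<ge>) ls"
  shows "row_length ls 2 \<le> row_length ls 1"
proof -
  have "ls ! 1 \<le> ls ! 0" if "2 \<le> length ls"
    using sorted_wrt_nth_less[OF assms, of 0 1] that by simp
  then show ?thesis by (auto simp: row_length_def)
qed

text \<open>The entries of a row that are at least the one in column \<open>k\<close> are those in the columns \<open>1, \<dots>, k\<close>, because
rows decrease. So columns can be found by counting, and comparing the entries of each column
shows the ballot condition.\<close>

lemma tableau_counts:
  assumes tab: "standard_tableau n ls A" and len: "length ls \<le> 2" and sorted: "sorted_wrt (\<ge>) ls"
  defines "D \<equiv> bottom_row ls A"
  shows "ballot D n"
    and "card ({0<..n} - D) = row_length ls 1" and "card ({0<..n} \<inter> D) = row_length ls 2"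
    and "\<And>i. i \<in> {1..n} \<Longrightarrow> column_of ls A i =
      (if i \<in> D then card ({i - 1<..n} \<inter> D) else card ({i - 1<..n} - D))"
proof -
  let ?b = "row_length ls 1" and ?c = "row_length ls 2"
  have cb: "?c \<le> ?b" using sorted by (rule row_length_mono)
  have bij: "bij_betw A (young_cells ls) {1..n}" using tab by (simp add: standard_tableau_def)
  have inj: "inj_on A (young_cells ls)" and img: "A ` young_cells ls = {1..n}"
    using bij by (auto simp: bij_betw_def)
  have row: "A (r, k') < A (r, k)" if "k \<in> {1..row_length ls r}" "k' \<in> {1..row_length ls r}" "k < k'" for r k k'
    using tab that unfolding standard_tableau_def mem_young_cells by blast
  have col: "A (2, k) < A (1, k)" if "k \<in> {1..?c}" for k
  proof -
    have "(1, k) \<in> young_cells ls" "(2, k) \<in> young_cells ls"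
      using that cb unfolding mem_young_cells by auto
    then show ?thesis using tab unfolding standard_tableau_def by auto
  qed
  have D: "D = (\<lambda>k. A (2, k)) ` {1..?c}"
    by (auto simp: D_def bottom_row_def mem_young_cells)
  have all: "{1..n} = (\<lambda>k. A (1, k)) ` {1..?b} \<union> (\<lambda>k. A (2, k)) ` {1..?c}"
    unfolding img[symmetric] young_cells_two_rows[OF len] by (simp add: image_Un image_image)
  have disj: "A (1, k) \<notin> D" if "k \<in> {1..?b}" for k
  proof
    assume "A (1, k) \<in> D"
    then obtain k' where k': "k' \<in> {1..?c}" "A (1, k) = A (2, k')" by (auto simp: D)
    have "(1, k) = (2 :: nat, k')"
      using inj_onD[OF inj k'(2)] that k'(1) by (simp add: mem_young_cells)
    then show False by simp
  qed
  have D_sub: "D \<subseteq> {1..n}" using all D by blast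
  have top: "{1..n} - D = (\<lambda>k. A (1, k)) ` {1..?b}"
  proof -
    have "{1..n} = (\<lambda>k. A (1, k)) ` {1..?b} \<union> D" using all D by simp
    then show ?thesis using disj by blast
  qed
  have inj_row: "inj_on (\<lambda>k. A (r, k)) {1..row_length ls r}" for r
  proof (rule inj_onI)
    fix k k' assume "k \<in> {1..row_length ls r}" "k' \<in> {1..row_length ls r}" "A (r, k) = A (r, k')"
    then show "k = k'" using row[of k r k'] row[of k' r k] by (cases k k' rule: linorder_cases) auto
  qed
  have le_row: "A (r, k) \<le> A (r, k') \<longleftrightarrow> k' \<le> k"
    if "k \<in> {1..row_length ls r}" "k' \<in> {1..row_length ls r}" for r k k'
    using row[OF that] row[OF that(2,1)] by (cases k k' rule: linorder_cases) auto
  have seg: "card {m \<in> (\<lambda>k. A (r, k)) ` {1..row_length ls r}. A (r, k) \<le> m} = k"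
    if k: "k \<in> {1..row_length ls r}" for r k
  proof -
    have "{m \<in> (\<lambda>k. A (r, k)) ` {1..row_length ls r}. A (r, k) \<le> m} = (\<lambda>k. A (r, k)) ` {1..k}"
      using le_row[OF k] k by auto
    moreover have "inj_on (\<lambda>k. A (r, k)) {1..k}"
      using inj_row by (rule inj_on_subset) (use k in auto)
    ultimately show ?thesis by (simp add: card_image)
  qed
  have zero: "{0<..n} = {1..n}" by auto
  show "ballot D n"
  proof
    fix i assume "i \<le> n"
    define K where "K = {k \<in> {1..?c}. i < A (2, k)}"
    have "{i<..n} \<inter> D = (\<lambda>k. A (2, k)) ` K"
      using D_sub unfolding D image_subset_iff K_def by auto
    moreover have "inj_on (\<lambda>k. A (2, k)) K"
      using inj_row by (rule inj_on_subset) (auto simp: K_def)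
    ultimately have "card ({i<..n} \<inter> D) = card K" by (simp add: card_image)
    moreover have "inj_on (\<lambda>k. A (1, k)) K"
      using inj_row by (rule inj_on_subset) (use cb in \<open>auto simp: K_def\<close>)
    moreover have "(\<lambda>k. A (1, k)) ` K \<subseteq> {i<..n} - D"
    proof (rule image_subsetI)
      fix k assume k: "k \<in> K"
      then have kb: "k \<in> {1..?b}" using cb by (auto simp: K_def)
      then have "A (1, k) \<in> {1..n} - D" using top by blast
      moreover have "i < A (1, k)" using col[of k] k by (auto simp: K_def)
      ultimately show "A (1, k) \<in> {i<..n} - D" by auto
    qed
    then have "card ((\<lambda>k. A (1, k)) ` K) \<le> card ({i<..n} - D)" by (intro card_mono) auto
    ultimately show "card ({i<..n} \<inter> D) \<le> card ({i<..n} - D)" by (simp add: card_image)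
  qed (rule D_sub)
  show "card ({0<..n} - D) = ?b"
    unfolding zero top using inj_row[of 1] by (simp add: card_image)
  have "{1..n} \<inter> D = D" using D_sub by blast
  then show "card ({0<..n} \<inter> D) = ?c"
    unfolding zero using inj_row[of 2] by (simp add: card_image D)
  fix i assume i: "i \<in> {1..n}"
  have ge: "{i - 1<..n} = {m \<in> {1..n}. i \<le> m}" using i by auto
  have inv: "column_of ls A (A (r, k)) = k" if "k \<in> {1..row_length ls r}" for r k
    using the_inv_into_f_f[OF inj, of "(r, k)"] that by (simp add: column_of_def mem_young_cells)
  show "column_of ls A i = (if i \<in> D then card ({i - 1<..n} \<inter> D) else card ({i - 1<..n} - D))"
  proof (cases "i \<in> D")
    case True
    then obtain k where k: "k \<in> {1..?c}" "i = A (2, k)" by (auto simp: D)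
    have "{i - 1<..n} \<inter> D = {m \<in> D. i \<le> m}" using D_sub unfolding ge by auto
    then show ?thesis using True inv[OF k(1)] seg[OF k(1)] by (simp add: k(2) D)
  next
    case False
    then have "i \<in> {1..n} - D" using i by blast
    then obtain k where k: "k \<in> {1..?b}" "i = A (1, k)" unfolding top by auto
    have "{i - 1<..n} - D = {m \<in> {1..n} - D. i \<le> m}" unfolding ge by auto
    then show ?thesis using False inv[OF k(1)] seg[OF k(1)] unfolding top by (simp add: k(2))
  qed
qed

section \<open>Coordinates from a Jordan basis\<close>

context complex_vector_space
begin

definition cell_coeff :: "seq \<Rightarrow> nat \<times> nat \<Rightarrow> complex" where
  "cell_coeff w x = (if fst x = 1 then w (snd x - 1) $ 1 else w (snd x - 1) $ 2)"

definition jordan_vec :: "nat list \<Rightarrow> (nat \<times> nat \<Rightarrow> 'v) \<Rightarrow> seq \<Rightarrow> 'v" where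
  "jordan_vec ls e w = (\<Sum>x\<in>young_cells ls. scl (cell_coeff w x) (e x))"

text \<open>The vector assigned to a sequence is linear in it, and on the sequences for the two block lengths it is
bijective since the Jordan basis is a basis. It intertwines the shift with \<open>N\<close>; hence so does its
inverse.\<close>

lemma jordan_coordinates:
  assumes N: "Vector_Spaces.linear scl scl N" and len: "length ls \<le> 2"
    and e: "inj_on e (young_cells ls)" "independent (e ` young_cells ls)" "span (e ` young_cells ls) = UNIV"
    and "\<forall>(r, c) \<in> young_cells ls. N (e (r, c)) = (if c = 1 then 0 else e (r, c - 1))"
  defines "J \<equiv> two_row_seqs (row_length ls 1) (row_length ls 2)"
  obtains coords where
    "\<And>x y. coords (x + y) = (\<lambda>k. coords x k + coords y k)"
    "\<And>c x. coords (scl c x) = (\<lambda>k. c *s coords x k)"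
    "\<And>v. jordan_vec ls e (coords v) = v"
    "\<And>v. coords v \<in> J"
    "\<And>w. w \<in> J \<Longrightarrow> coords (jordan_vec ls e w) = w"
    "\<And>v. coords (N v) = shift (coords v)"
proof -
  interpret N: Vector_Spaces.linear scl scl N by fact
  have Ne: "N (e (r, c)) = (if c = 1 then 0 else e (r, c - 1))" if "(r, c) \<in> young_cells ls" for r c
    using assms(6) that by blast
  let ?V = "jordan_vec ls e"
  have fin: "finite (young_cells ls)"
    unfolding young_cells_two_rows[OF len] by simp
  have V_add: "?V (\<lambda>k. v k + w k) = ?V v + ?V w" for v w
    by (simp add: jordan_vec_def cell_coeff_def sum.distrib[symmetric] scale_left_distrib[symmetric] if_distrib cong: if_cong)
       (auto intro!: sum.cong simp: scale_left_distrib)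
  have V_scale: "?V (\<lambda>k. c *s w k) = scl c (?V w)" for c w
    unfolding jordan_vec_def scale_sum_right by (intro sum.cong) (auto simp: cell_coeff_def)
  have J_add: "(\<lambda>k. v k + w k) \<in> J" and J_diff: "(\<lambda>k. v k - w k) \<in> J"
    if "v \<in> J" "w \<in> J" for v w
    using that by (auto simp: J_def two_row_seqs_def)
  have J_scale: "(\<lambda>k. c *s w k) \<in> J" if "w \<in> J" for w c
    using that by (auto simp: J_def two_row_seqs_def)
  have J_shift: "shift w \<in> J" if "w \<in> J" for w
    using that by (auto simp: J_def two_row_seqs_def shift_def)
  have J0: "w = (\<lambda>_. 0)" if w: "w \<in> J" "?V w = 0" for w
  proof
    fix k
    have co: "cell_coeff w x = 0" if "x \<in> young_cells ls" for x
      using independent_family_iff[OF fin, of e] e w(2) that unfolding jordan_vec_def by blast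
    have "w k $ 1 = 0"
      using co[of "(1, Suc k)"] w(1) by (cases "k < row_length ls 1") (auto simp: mem_young_cells cell_coeff_def J_def two_row_seqs_def)
    moreover have "w k $ 2 = 0"
      using co[of "(2, Suc k)"] w(1) by (cases "k < row_length ls 2") (auto simp: mem_young_cells cell_coeff_def J_def two_row_seqs_def)
    ultimately show "w k = 0" by (simp add: vec_eq_iff forall_2)
  qed
  have J_inj: "v = w" if "v \<in> J" "w \<in> J" "?V v = ?V w" for v w
  proof -
    have "?V v = ?V (\<lambda>k. v k - w k) + ?V w"
      unfolding V_add[symmetric] by simp
    then have "(\<lambda>k. v k - w k) = (\<lambda>_. 0)" using that(3) J0[OF J_diff[OF that(1,2)]] by simp
    then show ?thesis by (simp add: fun_eq_iff)
  qed
  have "\<exists>w\<in>J. ?V w = v" for v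
  proof -
    have "v \<in> span (e ` young_cells ls)" using e(3) by simp
    then obtain c where c: "v = (\<Sum>x\<in>young_cells ls. scl (c x) (e x))"
      unfolding span_family[OF fin] by auto
    define w :: seq where "w k = vector [if k < row_length ls 1 then c (1, Suc k) else 0,
        if k < row_length ls 2 then c (2, Suc k) else 0]" for k
    have "cell_coeff w x = c x" if "x \<in> young_cells ls" for x
      using that unfolding young_cells_two_rows[OF len] by (auto simp: cell_coeff_def w_def)
    then have "?V w = v" unfolding c jordan_vec_def by simp
    moreover have "w \<in> J" by (simp add: J_def two_row_seqs_def w_def)
    ultimately show ?thesis by blast
  qed
  then obtain coords where co: "\<And>v. coords v \<in> J" "\<And>v. ?V (coords v) = v" by metis
  \<comment> \<open>Both sides are sums over the cells that have a right neighbour: \<open>N\<close> kills the first column, and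
    the shifted sequence vanishes at the end of each row.\<close>
  have V_shift: "?V (shift w) = N (?V w)" if w: "w \<in> J" for w
  proof -
    let ?C = "young_cells ls"
    have "N (?V w) = (\<Sum>x\<in>?C. scl (cell_coeff w x) (N (e x)))"
      by (simp add: jordan_vec_def N.sum N.scale)
    also have "\<dots> = (\<Sum>x\<in>{x \<in> ?C. snd x \<noteq> 1}. scl (cell_coeff w x) (N (e x)))"
      using fin Ne by (intro sum.mono_neutral_right) auto
    also have "\<dots> = (\<Sum>y\<in>{y \<in> ?C. (fst y, Suc (snd y)) \<in> ?C}. scl (cell_coeff (shift w) y) (e y))"
    proof (rule sum.reindex_bij_witness[where i = "\<lambda>y. (fst y, Suc (snd y))" and j = "\<lambda>x. (fst x, snd x - 1)"])
      fix x assume "x \<in> {x \<in> ?C. snd x \<noteq> 1}"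
      then obtain r k where x: "x = (r, Suc (Suc k))" "(r, Suc (Suc k)) \<in> ?C"
        by (cases x; cases "snd x"; cases "snd x - 1") (auto simp: mem_young_cells)
      then show "(fst (fst x, snd x - 1), Suc (snd (fst x, snd x - 1))) = x"
        "(fst x, snd x - 1) \<in> {y \<in> ?C. (fst y, Suc (snd y)) \<in> ?C}"
        by (auto simp: mem_young_cells)
      show "scl (cell_coeff (shift w) (fst x, snd x - 1)) (e (fst x, snd x - 1)) = scl (cell_coeff w x) (N (e x))"
        using Ne[OF x(2)] by (simp add: x(1) cell_coeff_def shift_def)
    qed (auto simp: mem_young_cells)
    also have "\<dots> = ?V (shift w)"
      unfolding jordan_vec_def
    proof (rule sum.mono_neutral_left[OF fin])
      show "\<forall>y\<in>?C - {y \<in> ?C. (fst y, Suc (snd y)) \<in> ?C}. scl (cell_coeff (shift w) y) (e y) = 0"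
      proof
        fix y assume y: "y \<in> ?C - {y \<in> ?C. (fst y, Suc (snd y)) \<in> ?C}"
        then have "(fst y = 1 \<or> fst y = 2) \<and> snd y > 0 \<and> row_length ls (fst y) \<le> snd y"
          using young_cells_two_rows[OF len] by (auto simp: mem_young_cells)
        then have "cell_coeff (shift w) y = 0"
          using w by (auto simp: cell_coeff_def shift_def J_def two_row_seqs_def)
        then show "scl (cell_coeff (shift w) y) (e y) = 0" by simp
      qed
    qed auto
    finally show ?thesis by simp
  qed
  show ?thesis
  proof (rule that[of coords])
    show "coords (x + y) = (\<lambda>k. coords x k + coords y k)" for x y
      by (rule J_inj) (simp_all add: co J_add V_add)
    show "coords (scl c x) = (\<lambda>k. c *s coords x k)" for c x
      by (rule J_inj) (simp_all add: co J_scale V_scale)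
    show "coords (jordan_vec ls e w) = w" if "w \<in> J" for w
      by (rule J_inj) (simp_all add: co that)
    show "coords (N v) = shift (coords v)" for v
      by (rule J_inj) (simp_all add: co J_shift V_shift)
  qed (rule co)+
qed

lemma continuous_jordan_vec:
  assumes s: "\<And>k. continuous_map Z euclidean (\<lambda>z. s z k)" and len: "length ls \<le> 2"
  shows "continuous_map Z (vs_topology scl) (\<lambda>z. jordan_vec ls e (s z))"
  unfolding continuous_into_vs_topology_iff
proof (intro allI impI)
  fix f assume f: "linear_functional f"
  have "continuous_map Z euclidean (\<lambda>z. cell_coeff (s z) x)" for x
    unfolding cell_coeff_def by (cases "fst x = 1") (simp_all add: continuous_map_vec_component s)
  then have "continuous_map Z euclidean (\<lambda>z. \<Sum>x\<in>young_cells ls. cell_coeff (s z) x * f (e x))"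
    using young_cells_two_rows[OF len]
    by (intro continuous_map_sum continuous_map_mult_algebra) auto
  then show "continuous_map Z euclidean (\<lambda>z. f (jordan_vec ls e (s z)))"
    using f by (simp add: jordan_vec_def linear_functional_props)
qed

end

theorem theorem5p3:
  fixes scl :: "complex \<Rightarrow> 'v::ab_group_add \<Rightarrow> 'v"
    and basis :: "'v set"
    and n :: nat
    and N :: "'v \<Rightarrow> 'v"
    and ls :: "nat list"
    and A :: "nat \<times> nat \<Rightarrow> nat"
  assumes "finite_dimensional_vector_space scl basis"
    and "vector_space.dim scl (UNIV :: 'v set) = n"
    and "Vector_Spaces.linear scl scl N"
    and "nilpotent_map N"
    and "jordan_shape scl N ls"
    and "length ls \<le> 2"
    and "standard_tableau n ls A"
  shows "iterated_fiber_bundle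
           (subtopology (flag_variety scl n) (springer_component scl n N ls A))
           (replicate (card (bottom_row ls A)) projective_line)"
proof -
  interpret finite_dimensional_vector_space scl basis by fact
  interpret complex_vector_space scl by unfold_locales
  interpret N: Vector_Spaces.linear scl scl N by fact
  define D where "D = bottom_row ls A"
  have sorted: "sorted_wrt (\<ge>) ls" using assms(5) by (simp add: jordan_shape_def)
  obtain e where e: "inj_on e (young_cells ls)" "independent (e ` young_cells ls)"
      "span (e ` young_cells ls) = UNIV"
      "\<forall>(r, c) \<in> young_cells ls. N (e (r, c)) = (if c = 1 then 0 else e (r, c - 1))"
    using assms(5) unfolding jordan_shape_def by blast
  note counts = tableau_counts[OF assms(7,6) sorted, folded D_def]
  interpret ballot D n by (rule counts(1))
  have rows: "tops 0 = row_length ls 1" "bots 0 = row_length ls 2"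
    unfolding tops_def bots_def by (rule counts(2,3))+
  obtain coords where coords:
    "\<And>x y. coords (x + y) = (\<lambda>k. coords x k + coords y k)"
    "\<And>c x. coords (scl c x) = (\<lambda>k. c *s coords x k)"
    "\<And>v. jordan_vec ls e (coords v) = v"
    "\<And>v. coords v \<in> two_row_seqs (tops 0) (bots 0)"
    "\<And>w. w \<in> two_row_seqs (tops 0) (bots 0) \<Longrightarrow> coords (jordan_vec ls e w) = w"
    "\<And>v. coords (N v) = shift (coords v)"
  proof (rule jordan_coordinates[OF assms(3,6) e, folded rows], goal_cases)
    case (1 coords)
    show ?case by (rule 1(1)[OF 1(2-7)])
  qed
  interpret two_row_nilpotent scl D n basis N coords "jordan_vec ls e"
  proof unfold_locales
    show "continuous_map Z (vs_topology scl) (\<lambda>z. jordan_vec ls e (s z))"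
      if "\<And>k. continuous_map Z euclidean (\<lambda>z. s z k)"
      for Z :: "(nat \<Rightarrow> (complex ^ 2) set) topology" and s
      using that assms(6) by (rule continuous_jordan_vec)
  qed (rule assms(2) coords N.add N.scale | assumption)+
  have "column_of ls A i = column (i - 1)" if "i \<in> {1..n}" for i
    using counts(4)[OF that] that by (simp add: column_def bots_def tops_def)
  then have "SV scl n N ls A = tableau_cell"
    unfolding SV_def tableau_cell_def by (intro Collect_cong conj_cong ball_cong refl) auto
  then have comp: "springer_component scl n N ls A = flag_of ` (D \<rightarrow>\<^sub>E lines)"
    unfolding springer_component_def by (simp add: closure_tableau_cell)
  have "finite D" using D_sub finite_subset by blast
  moreover have "topspace projective_line \<noteq> {}"
    using first_line unfolding topspace_projective_line by blast
  ultimately show ?thesis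
    unfolding comp D_def[symmetric]
    using homeomorphic_map_flag_of by (intro iterated_fiber_bundle_of_product)
qed

end
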